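(* Let $p:\mathcal{A}\to\mathcal{X}$ be a Fell bundle over a locally compact groupoid, and let $G$ and $H$ be locally compact groups. Suppose that $G$ and $H$ act (by automorphisms) freely and properly on the left and right, respectively, of $\mathcal{A}$, and that the actions commute. Then: (i) $G$ acts on the left of the orbit bundle $\mathcal{A}/H$ by $s\cdot(a\cdot H)=(s\cdot a)\cdot H$; (ii) the semidirect-product Fell bundle $\mathcal{A}/H\rtimes G$ acts on the left of the Banach bundle $\mathcal{A}$ by $(a\cdot H,t)\cdot b=a(t\cdot b)$ whenever $s(a)=r(p(t\cdot b))$.
   Context: Conventions. All spaces, groups and groupoids are locally compact, Hausdorff and second countable; the given groupoid carries a left Haar system (so $r,s$ are continuous and open). Banach bundles. A (upper semicontinuous) Banach bundle is a continuous open surjection whose fibres are complex Banach spaces, such that the norm is upper semicontinuous on the total space, addition and scalar multiplication are continuous, and any net whose base points converge to $\omega$ and whose norms tend to $0$ converges to $0_\omega$. Bundles are separable: the Banach space of continuous sections vanishing at infinity is separable. Fell bundles. A Fell bundle $p:\mathcal{A}\to\mathcal{X}$ is a separable Banach bundle with a continuous associative multiplication $(a,b)\mapsto ab$ defined when $s(p(a))=r(p(b))$, bilinear on fibres with $p(ab)=p(a)p(b)$, and a continuous conjugate-linear involution with $p(a^* )=p(a)^{-1}$, $(ab)^*=b^*a^*$, $a^{**}=a$, such that each fibre $A(u)$, $u\in\mathcal{X}^{(0)}$, is a $C^*$-algebra and each fibre $A(x)$ is an $A(r(x))$–$A(s(x))$ imprimitivity bimodule under multiplication with inner products $ab^*$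 and $a^*b$. Write $s(a)=s(p(a))$, $r(a)=r(p(a))$. Group actions. A left action of $G$ on $\mathcal{X}$ by automorphisms is a continuous map $(s,x)\mapsto s\cdot x$ with each $x\mapsto s\cdot x$ a groupoid automorphism and $s\cdot(t\cdot x)=(st)\cdot x$. A left action of $G$ on $\mathcal{A}$ (by automorphisms) consists of such an action on $\mathcal{X}$ and a continuous map $G\times\mathcal{A}\to\mathcal{A}$ with each $a\mapsto s\cdot a$ a Fell bundle automorphism (fibrewise linear isometric, preserving product and involution, $p(s\cdot a)=s\cdot p(a)$) and $s\cdot(t\cdot a)=(st)\cdot a$. Right actions are analogous. The action on $\mathcal{A}$ is free and proper if the action on the space $\mathcal{X}$ is. Orbit bundle. $\mathcal{X}/H$ is a groupoid with $(x\cdot H)(y\cdot H)=(xy)\cdot H$ when $s(x)=r(y)$; $\mathcal{A}/H\to\mathcal{X}/H$ is a Fell bundle with $p(a\cdot H)=p(a)\cdot H$, $(a\cdot H)(b\cdot H)=(ab)\cdot H$ if $s(a)=r(b)$, $(a\cdot H)^*=a^*\cdot H$, $\|a\cdot H\|=\|a\|$. $G$ acts on $\mathcal{X}/H$ by $s\cdot(x\cdot H)=(s\cdot x)\cdot H$. Semidirect product. If $G$ acts on the left of a Fell bundle $\mathcal{C}\to\mathcal{Z}$, then $\mathcal{Z}\rtimes G=\mathcal{Z}\times G$ with $(x,s)(y,t)=(x(s\cdot y),st)$, $(x,s)^{-1}=(s^{-1}\cdot x^{-1},s^{-1})$, $r(x,t)=(r(x),e)$, $s(x,t)=(t^{-1}\cdot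 s(x),e)$; $\mathcal{C}\rtimes G=\mathcal{C}\times G$ is the Fell bundle over it with $p(a,s)=(p(a),s)$, $(a,s)(b,t)=(a(s\cdot b),st)$, $(a,s)^*=(s^{-1}\cdot a^*,s^{-1})$. $\mathcal{A}/H\rtimes G$ means $(\mathcal{A}/H)\rtimes G$. Actions on Banach bundles. A left action of a groupoid $\mathcal{Z}$ on a space $\Omega$ consists of a continuous open fibring map $\rho:\Omega\to\mathcal{Z}^{(0)}$ and a continuous map $(z,u)\mapsto z\cdot u$ on $\{s(z)=\rho(u)\}$ with $\rho(z\cdot u)=r(z)$, $(zw)\cdot u=z\cdot(w\cdot u)$, $\rho(u)\cdot u=u$. A left action of a Fell bundle $\mathcal{C}\to\mathcal{Z}$ on a Banach bundle $q:\mathcal{E}\to\Omega$ (where $\mathcal{Z}$ acts on $\Omega$) is a continuous fibrewise bilinear map $(c,e)\mapsto c\cdot e$ defined when $s(c)=\rho(q(e))$ with $q(c\cdot e)=p(c)\cdot q(e)$, $c\cdot(d\cdot e)=(cd)\cdot e$, $\|c\cdot e\|\le\|c\|\|e\|$. Here $\mathcal{X}/H\rtimes G$ acts on the space $\mathcal{X}$ by $(x\cdot H,t)\cdot y=x(t\cdot y)$ when $s(x)=r(t\cdot y)$, with fibring map $x\mapsto(r(x)\cdot H,e)$. *)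

theory Defs
  imports "HOL-Analysis.Analysis" "HOL-Algebra.Group"
begin

section \<open>Complex Banach spaces, C*-algebras and imprimitivity bimodules on carrier sets\<close>

text \<open>
  The fibres of a bundle are subsets of one type, so the type classes for normed spaces do not
  apply to them and the structures below are relative to a carrier.
\<close>

record 'a nspace =
  npts :: "'a set"
  nadd :: "'a \<Rightarrow> 'a \<Rightarrow> 'a"
  nzero :: 'a
  nscl :: "complex \<Rightarrow> 'a \<Rightarrow> 'a"
  nnorm :: "'a \<Rightarrow> real"

record 'a cstar = "'a nspace" +
  cmul :: "'a \<Rightarrow> 'a \<Rightarrow> 'a"
  cadj :: "'a \<Rightarrow> 'a"

definition nsub :: "('a, 'm) nspace_scheme \<Rightarrow> 'a \<Rightarrow> 'a \<Rightarrow> 'a" where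
  "nsub V a b = nadd V a (nscl V (-1) b)"

definition complex_vector_space :: "('a, 'm) nspace_scheme \<Rightarrow> bool" where
  "complex_vector_space V \<longleftrightarrow>
     comm_group \<lparr>carrier = npts V, monoid.mult = nadd V, one = nzero V\<rparr> \<and>
     (\<forall>c. \<forall>a\<in>npts V. nscl V c a \<in> npts V) \<and>
     (\<forall>c. \<forall>a\<in>npts V. \<forall>b\<in>npts V. nscl V c (nadd V a b) = nadd V (nscl V c a) (nscl V c b)) \<and>
     (\<forall>c d. \<forall>a\<in>npts V. nscl V (c + d) a = nadd V (nscl V c a) (nscl V d a)) \<and>
     (\<forall>c d. \<forall>a\<in>npts V. nscl V (c * d) a = nscl V c (nscl V d a)) \<and>
     (\<forall>a\<in>npts V. nscl V 1 a = a)"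

definition complex_banach_space :: "('a, 'm) nspace_scheme \<Rightarrow> bool" where
  "complex_banach_space V \<longleftrightarrow>
     complex_vector_space V \<and>
     (\<forall>a\<in>npts V. 0 \<le> nnorm V a \<and> (nnorm V a = 0 \<longleftrightarrow> a = nzero V)) \<and>
     (\<forall>c. \<forall>a\<in>npts V. nnorm V (nscl V c a) = cmod c * nnorm V a) \<and>
     (\<forall>a\<in>npts V. \<forall>b\<in>npts V. nnorm V (nadd V a b) \<le> nnorm V a + nnorm V b) \<and>
     (\<forall>f :: nat \<Rightarrow> 'a.
        (\<forall>n. f n \<in> npts V) \<and>
        (\<forall>\<epsilon>>0. \<exists>N. \<forall>m\<ge>N. \<forall>n\<ge>N. nnorm V (nsub V (f m) (f n)) < \<epsilon>) \<longrightarrow>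
        (\<exists>l\<in>npts V. (\<lambda>n. nnorm V (nsub V (f n) l)) \<longlonglongrightarrow> 0))"

definition linear_between ::
  "('a, 'm) nspace_scheme \<Rightarrow> ('b, 'n) nspace_scheme \<Rightarrow> ('a \<Rightarrow> 'b) \<Rightarrow> bool" where
  "linear_between V W f \<longleftrightarrow>
     (\<forall>a\<in>npts V. f a \<in> npts W) \<and>
     (\<forall>a\<in>npts V. \<forall>b\<in>npts V. f (nadd V a b) = nadd W (f a) (f b)) \<and>
     (\<forall>c. \<forall>a\<in>npts V. f (nscl V c a) = nscl W c (f a))"

definition conj_linear_between ::
  "('a, 'm) nspace_scheme \<Rightarrow> ('b, 'n) nspace_scheme \<Rightarrow> ('a \<Rightarrow> 'b) \<Rightarrow> bool" where
  "conj_linear_between V W f \<longleftrightarrow>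
     (\<forall>a\<in>npts V. f a \<in> npts W) \<and>
     (\<forall>a\<in>npts V. \<forall>b\<in>npts V. f (nadd V a b) = nadd W (f a) (f b)) \<and>
     (\<forall>c. \<forall>a\<in>npts V. f (nscl V c a) = nscl W (cnj c) (f a))"

definition bilinear_between ::
  "('a, 'm) nspace_scheme \<Rightarrow> ('b, 'n) nspace_scheme \<Rightarrow> ('c, 'k) nspace_scheme \<Rightarrow>
   ('a \<Rightarrow> 'b \<Rightarrow> 'c) \<Rightarrow> bool" where
  "bilinear_between U V W f \<longleftrightarrow>
     (\<forall>a\<in>npts U. linear_between V W (f a)) \<and>
     (\<forall>b\<in>npts V. linear_between U W (\<lambda>a. f a b))"

definition cstar_algebra :: "('a, 'm) cstar_scheme \<Rightarrow> bool" where
  "cstar_algebra B \<longleftrightarrow>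
     complex_banach_space B \<and>
     bilinear_between B B B (cmul B) \<and>
     (\<forall>a\<in>npts B. \<forall>b\<in>npts B. \<forall>c\<in>npts B. cmul B (cmul B a b) c = cmul B a (cmul B b c)) \<and>
     conj_linear_between B B (cadj B) \<and>
     (\<forall>a\<in>npts B. cadj B (cadj B a) = a) \<and>
     (\<forall>a\<in>npts B. \<forall>b\<in>npts B. cadj B (cmul B a b) = cmul B (cadj B b) (cadj B a)) \<and>
     (\<forall>a\<in>npts B. \<forall>b\<in>npts B. nnorm B (cmul B a b) \<le> nnorm B a * nnorm B b) \<and>
     (\<forall>a\<in>npts B. nnorm B (cmul B (cadj B a) a) = (nnorm B a)\<^sup>2)"

definition cstar_positive :: "('a, 'm) cstar_scheme \<Rightarrow> 'a set" where
  "cstar_positive B = {cmul B (cadj B b) b | b. b \<in> npts B}"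

inductive_set lin_span :: "('a, 'm) nspace_scheme \<Rightarrow> 'a set \<Rightarrow> 'a set"
  for V :: "('a, 'm) nspace_scheme" and S :: "'a set" where
  span_zero: "nzero V \<in> lin_span V S"
| span_base: "a \<in> S \<Longrightarrow> a \<in> lin_span V S"
| span_add: "a \<in> lin_span V S \<Longrightarrow> b \<in> lin_span V S \<Longrightarrow> nadd V a b \<in> lin_span V S"
| span_scl: "a \<in> lin_span V S \<Longrightarrow> nscl V c a \<in> lin_span V S"

definition densely_spans :: "('a, 'm) nspace_scheme \<Rightarrow> 'a set \<Rightarrow> bool" where
  "densely_spans V S \<longleftrightarrow>
     (\<forall>a\<in>npts V. \<forall>\<epsilon>>0. \<exists>b\<in>lin_span V S. nnorm V (nsub V a b) < \<epsilon>)"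

text \<open>
  The norm of a Hilbert module is the one given by its inner product, and completeness is
  completeness for that norm. Right inner products are conjugate linear in the first variable,
  left ones in the second.
\<close>

definition full_right_hilbert_module ::
  "('b, 'm) cstar_scheme \<Rightarrow> ('e, 'n) nspace_scheme \<Rightarrow> ('e \<Rightarrow> 'b \<Rightarrow> 'e) \<Rightarrow> ('e \<Rightarrow> 'e \<Rightarrow> 'b) \<Rightarrow> bool"
  where
  "full_right_hilbert_module B E ract rip \<longleftrightarrow>
     cstar_algebra B \<and> complex_banach_space E \<and>
     bilinear_between E B E ract \<and>
     (\<forall>x\<in>npts E. \<forall>a\<in>npts B. \<forall>b\<in>npts B. ract (ract x a) b = ract x (cmul B a b)) \<and>
     (\<forall>x\<in>npts E. linear_between E B (rip x)) \<and>
     (\<forall>x\<in>npts E. \<forall>y\<in>npts E. \<forall>b\<in>npts B. rip x (ract y b) = cmul B (rip x y) b) \<and>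
     (\<forall>x\<in>npts E. \<forall>y\<in>npts E. cadj B (rip x y) = rip y x) \<and>
     (\<forall>x\<in>npts E. rip x x \<in> cstar_positive B) \<and>
     (\<forall>x\<in>npts E. rip x x = nzero B \<longrightarrow> x = nzero E) \<and>
     (\<forall>x\<in>npts E. nnorm E x = sqrt (nnorm B (rip x x))) \<and>
     densely_spans B {rip x y | x y. x \<in> npts E \<and> y \<in> npts E}"

definition full_left_hilbert_module ::
  "('a, 'm) cstar_scheme \<Rightarrow> ('e, 'n) nspace_scheme \<Rightarrow> ('a \<Rightarrow> 'e \<Rightarrow> 'e) \<Rightarrow> ('e \<Rightarrow> 'e \<Rightarrow> 'a) \<Rightarrow> bool"
  where
  "full_left_hilbert_module A E lact lip \<longleftrightarrow>
     cstar_algebra A \<and> complex_banach_space E \<and>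
     bilinear_between A E E lact \<and>
     (\<forall>a\<in>npts A. \<forall>b\<in>npts A. \<forall>x\<in>npts E. lact a (lact b x) = lact (cmul A a b) x) \<and>
     (\<forall>y\<in>npts E. linear_between E A (\<lambda>x. lip x y)) \<and>
     (\<forall>a\<in>npts A. \<forall>x\<in>npts E. \<forall>y\<in>npts E. lip (lact a x) y = cmul A a (lip x y)) \<and>
     (\<forall>x\<in>npts E. \<forall>y\<in>npts E. cadj A (lip x y) = lip y x) \<and>
     (\<forall>x\<in>npts E. lip x x \<in> cstar_positive A) \<and>
     (\<forall>x\<in>npts E. lip x x = nzero A \<longrightarrow> x = nzero E) \<and>
     (\<forall>x\<in>npts E. nnorm E x = sqrt (nnorm A (lip x x))) \<and>
     densely_spans A {lip x y | x y. x \<in> npts E \<and> y \<in> npts E}"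

definition imprimitivity_bimodule ::
  "('a, 'm) cstar_scheme \<Rightarrow> ('b, 'n) cstar_scheme \<Rightarrow> ('e, 'k) nspace_scheme \<Rightarrow>
   ('a \<Rightarrow> 'e \<Rightarrow> 'e) \<Rightarrow> ('e \<Rightarrow> 'b \<Rightarrow> 'e) \<Rightarrow> ('e \<Rightarrow> 'e \<Rightarrow> 'a) \<Rightarrow> ('e \<Rightarrow> 'e \<Rightarrow> 'b) \<Rightarrow> bool" where
  "imprimitivity_bimodule A B E lact ract lip rip \<longleftrightarrow>
     full_left_hilbert_module A E lact lip \<and>
     full_right_hilbert_module B E ract rip \<and>
     (\<forall>a\<in>npts A. \<forall>x\<in>npts E. \<forall>b\<in>npts B. ract (lact a x) b = lact a (ract x b)) \<and>
     (\<forall>a\<in>npts A. \<forall>x\<in>npts E. \<forall>y\<in>npts E. rip (lact a x) y = rip x (lact (cadj A a) y)) \<and>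
     (\<forall>b\<in>npts B. \<forall>x\<in>npts E. \<forall>y\<in>npts E. lip (ract x b) y = lip x (ract y (cadj B b))) \<and>
     (\<forall>x\<in>npts E. \<forall>y\<in>npts E. \<forall>z\<in>npts E. lact (lip x y) z = ract x (rip y z))"


section \<open>Locally compact groups and groupoids\<close>

definition lchs_space :: "'x topology \<Rightarrow> bool" where
  "lchs_space T \<longleftrightarrow> locally_compact_space T \<and> Hausdorff_space T \<and> second_countable T"

record 'g top_group = "'g monoid" +
  gr_top :: "'g topology"

definition lc_group :: "('g, 'm) top_group_scheme \<Rightarrow> bool" where
  "lc_group G \<longleftrightarrow>
     group G \<and> topspace (gr_top G) = carrier G \<and> lchs_space (gr_top G) \<and>
     continuous_map (prod_topology (gr_top G) (gr_top G)) (gr_top G) (\<lambda>(s, t). s \<otimes>\<^bsub>G\<^esub> t) \<and>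
     continuous_map (gr_top G) (gr_top G) (m_inv G)"

record 'x groupoid =
  gtop :: "'x topology"
  rng :: "'x \<Rightarrow> 'x"
  src :: "'x \<Rightarrow> 'x"
  gmul :: "'x \<Rightarrow> 'x \<Rightarrow> 'x"
  ginv :: "'x \<Rightarrow> 'x"

abbreviation arrows :: "('x, 'm) groupoid_scheme \<Rightarrow> 'x set" where
  "arrows X \<equiv> topspace (gtop X)"

definition units :: "('x, 'm) groupoid_scheme \<Rightarrow> 'x set" where
  "units X = {u \<in> arrows X. rng X u = u}"

definition algebraic_groupoid :: "('x, 'm) groupoid_scheme \<Rightarrow> bool" where
  "algebraic_groupoid X \<longleftrightarrow>
     (\<forall>x\<in>arrows X. rng X x \<in> arrows X \<and> src X x \<in> arrows X \<and>
        rng X (rng X x) = rng X x \<and> src X (rng X x) = rng X x \<and>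
        rng X (src X x) = src X x \<and> src X (src X x) = src X x) \<and>
     (\<forall>x\<in>arrows X. \<forall>y\<in>arrows X. src X x = rng X y \<longrightarrow>
        gmul X x y \<in> arrows X \<and> rng X (gmul X x y) = rng X x \<and> src X (gmul X x y) = src X y) \<and>
     (\<forall>x\<in>arrows X. \<forall>y\<in>arrows X. \<forall>z\<in>arrows X. src X x = rng X y \<and> src X y = rng X z \<longrightarrow>
        gmul X (gmul X x y) z = gmul X x (gmul X y z)) \<and>
     (\<forall>x\<in>arrows X. gmul X (rng X x) x = x \<and> gmul X x (src X x) = x) \<and>
     (\<forall>x\<in>arrows X. ginv X x \<in> arrows X \<and> rng X (ginv X x) = src X x \<and> src X (ginv X x) = rng X x \<and>
        gmul X x (ginv X x) = rng X x \<and> gmul X (ginv X x) x = src X x)"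

text \<open>
  Continuity of the range and source maps follows from \<^term>\<open>rng X x = gmul X x (ginv X x)\<close> and
  its analogue for \<^term>\<open>src X\<close>; their openness follows from the existence of a Haar system below.
\<close>

definition lc_groupoid :: "('x, 'm) groupoid_scheme \<Rightarrow> bool" where
  "lc_groupoid X \<longleftrightarrow>
     algebraic_groupoid X \<and> lchs_space (gtop X) \<and>
     continuous_map
       (subtopology (prod_topology (gtop X) (gtop X)) {(x, y). src X x = rng X y}) (gtop X)
       (\<lambda>(x, y). gmul X x y) \<and>
     continuous_map (gtop X) (gtop X) (ginv X)"

definition cc_function :: "'x topology \<Rightarrow> ('x \<Rightarrow> complex) \<Rightarrow> bool" where
  "cc_function T f \<longleftrightarrow>
     continuous_map T euclidean f \<and> (\<exists>K. compactin T K \<and> (\<forall>x\<in>topspace T - K. f x = 0))"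

text \<open>
  On a second countable locally compact Hausdorff space the Radon measures are the Borel measures
  that are finite on compact sets. The null set and positivity conditions say that the support of
  \<open>\<nu> u\<close> is the set of arrows with range \<open>u\<close>.
\<close>

definition left_haar_system :: "('x, 'm) groupoid_scheme \<Rightarrow> ('x \<Rightarrow> 'x measure) \<Rightarrow> bool" where
  "left_haar_system X \<nu> \<longleftrightarrow>
     (\<forall>u\<in>units X.
        space (\<nu> u) = arrows X \<and>
        sets (\<nu> u) = sigma_sets (arrows X) {U. openin (gtop X) U} \<and>
        (\<forall>K. compactin (gtop X) K \<longrightarrow> emeasure (\<nu> u) K < \<infinity>) \<and>
        emeasure (\<nu> u) {x \<in> arrows X. rng X x \<noteq> u} = 0 \<and>
        (\<forall>U. openin (gtop X) U \<and> (\<exists>x\<in>U. rng X x = u) \<longrightarrow> 0 < emeasure (\<nu> u) U)) \<and>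
     (\<forall>f. cc_function (gtop X) f \<longrightarrow>
        continuous_map (subtopology (gtop X) (units X)) euclidean (\<lambda>u. integral\<^sup>L (\<nu> u) f)) \<and>
     (\<forall>f x. cc_function (gtop X) f \<and> x \<in> arrows X \<longrightarrow>
        set_lebesgue_integral (\<nu> (src X x)) {y \<in> arrows X. rng X y = src X x} (\<lambda>y. f (gmul X x y))
        = integral\<^sup>L (\<nu> (rng X x)) f)"


section \<open>Banach bundles and Fell bundles\<close>

record ('a, 'x) bbundle =
  btop :: "'a topology"
  proj :: "'a \<Rightarrow> 'x"
  badd :: "'a \<Rightarrow> 'a \<Rightarrow> 'a"
  bscl :: "complex \<Rightarrow> 'a \<Rightarrow> 'a"
  bzero :: "'x \<Rightarrow> 'a"
  bnorm :: "'a \<Rightarrow> real"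

record ('a, 'x) fell = "('a, 'x) bbundle" +
  fmul :: "'a \<Rightarrow> 'a \<Rightarrow> 'a"
  fadj :: "'a \<Rightarrow> 'a"

abbreviation tot_space :: "('a, 'x, 'm) bbundle_scheme \<Rightarrow> 'a set" where
  "tot_space E \<equiv> topspace (btop E)"

definition fibre :: "('a, 'x, 'm) bbundle_scheme \<Rightarrow> 'x \<Rightarrow> 'a nspace" where
  "fibre E x = \<lparr>npts = {a \<in> tot_space E. proj E a = x}, nadd = badd E, nzero = bzero E x,
     nscl = bscl E, nnorm = bnorm E\<rparr>"

definition fibre_algebra :: "('a, 'x, 'm) fell_scheme \<Rightarrow> 'x \<Rightarrow> 'a cstar" where
  "fibre_algebra A u = \<lparr>npts = {a \<in> tot_space A. proj A a = u}, nadd = badd A, nzero = bzero A u,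
     nscl = bscl A, nnorm = bnorm A, cmul = fmul A, cadj = fadj A\<rparr>"

text \<open>
  Convergence of nets is stated through filters on the total space, which is equivalent and avoids
  quantifying over index types.
\<close>

definition banach_bundle :: "'x topology \<Rightarrow> ('a, 'x, 'm) bbundle_scheme \<Rightarrow> bool" where
  "banach_bundle T E \<longleftrightarrow>
     continuous_map (btop E) T (proj E) \<and> open_map (btop E) T (proj E) \<and>
     proj E ` tot_space E = topspace T \<and>
     (\<forall>x\<in>topspace T. complex_banach_space (fibre E x)) \<and>
     (\<forall>\<epsilon>. openin (btop E) {a \<in> tot_space E. bnorm E a < \<epsilon>}) \<and>
     continuous_map
       (subtopology (prod_topology (btop E) (btop E)) {(a, b). proj E a = proj E b}) (btop E)
       (\<lambda>(a, b). badd E a b) \<and>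
     continuous_map (prod_topology euclidean (btop E)) (btop E) (\<lambda>(c, a). bscl E c a) \<and>
     (\<forall>F x. eventually (\<lambda>a. a \<in> tot_space E) F \<and> limitin T (proj E) x F \<and> (bnorm E \<longlongrightarrow> 0) F \<longrightarrow>
        limitin (btop E) (\<lambda>a. a) (bzero E x) F)"

definition c0_sections :: "'x topology \<Rightarrow> ('a, 'x, 'm) bbundle_scheme \<Rightarrow> ('x \<Rightarrow> 'a) set" where
  "c0_sections T E = {f. continuous_map T (btop E) f \<and> (\<forall>x\<in>topspace T. proj E (f x) = x) \<and>
     (\<forall>\<epsilon>>0. compactin T {x \<in> topspace T. \<epsilon> \<le> bnorm E (f x)})}"

text \<open>Separability of the space of sections in the supremum norm.\<close>

definition separable_bundle :: "'x topology \<Rightarrow> ('a, 'x, 'm) bbundle_scheme \<Rightarrow> bool" where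
  "separable_bundle T E \<longleftrightarrow>
     (\<exists>D. countable D \<and> D \<subseteq> c0_sections T E \<and>
        (\<forall>f\<in>c0_sections T E. \<forall>\<epsilon>>0. \<exists>g\<in>D. \<forall>x\<in>topspace T.
           bnorm E (nsub (fibre E x) (f x) (g x)) \<le> \<epsilon>))"

definition fell_bundle :: "('x, 'k) groupoid_scheme \<Rightarrow> ('a, 'x, 'm) fell_scheme \<Rightarrow> bool" where
  "fell_bundle X A \<longleftrightarrow>
     banach_bundle (gtop X) A \<and> separable_bundle (gtop X) A \<and>
     continuous_map
       (subtopology (prod_topology (btop A) (btop A)) {(a, b). src X (proj A a) = rng X (proj A b)})
       (btop A) (\<lambda>(a, b). fmul A a b) \<and>
     (\<forall>x\<in>arrows X. \<forall>y\<in>arrows X. src X x = rng X y \<longrightarrow>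
        bilinear_between (fibre A x) (fibre A y) (fibre A (gmul X x y)) (fmul A)) \<and>
     (\<forall>a\<in>tot_space A. \<forall>b\<in>tot_space A. \<forall>c\<in>tot_space A.
        src X (proj A a) = rng X (proj A b) \<and> src X (proj A b) = rng X (proj A c) \<longrightarrow>
        fmul A (fmul A a b) c = fmul A a (fmul A b c)) \<and>
     continuous_map (btop A) (btop A) (fadj A) \<and>
     (\<forall>x\<in>arrows X. conj_linear_between (fibre A x) (fibre A (ginv X x)) (fadj A)) \<and>
     (\<forall>a\<in>tot_space A. fadj A (fadj A a) = a) \<and>
     (\<forall>a\<in>tot_space A. \<forall>b\<in>tot_space A. src X (proj A a) = rng X (proj A b) \<longrightarrow>
        fadj A (fmul A a b) = fmul A (fadj A b) (fadj A a)) \<and>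
     (\<forall>u\<in>units X. cstar_algebra (fibre_algebra A u)) \<and>
     (\<forall>x\<in>arrows X.
        imprimitivity_bimodule (fibre_algebra A (rng X x)) (fibre_algebra A (src X x)) (fibre A x)
          (fmul A) (fmul A) (\<lambda>a b. fmul A a (fadj A b)) (\<lambda>a b. fmul A (fadj A a) b))"


section \<open>Group actions\<close>

definition groupoid_automorphism :: "('x, 'm) groupoid_scheme \<Rightarrow> ('x \<Rightarrow> 'x) \<Rightarrow> bool" where
  "groupoid_automorphism X f \<longleftrightarrow>
     homeomorphic_map (gtop X) (gtop X) f \<and>
     (\<forall>x\<in>arrows X. rng X (f x) = f (rng X x) \<and> src X (f x) = f (src X x)) \<and>
     (\<forall>x\<in>arrows X. \<forall>y\<in>arrows X. src X x = rng X y \<longrightarrow> f (gmul X x y) = gmul X (f x) (f y))"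

text \<open>\<open>\<phi>\<close> is an automorphism of the bundle covering the automorphism \<open>f\<close> of the base.\<close>

definition fell_automorphism ::
  "('x, 'k) groupoid_scheme \<Rightarrow> ('a, 'x, 'm) fell_scheme \<Rightarrow> ('x \<Rightarrow> 'x) \<Rightarrow> ('a \<Rightarrow> 'a) \<Rightarrow> bool" where
  "fell_automorphism X A f \<phi> \<longleftrightarrow>
     groupoid_automorphism X f \<and>
     homeomorphic_map (btop A) (btop A) \<phi> \<and>
     (\<forall>a\<in>tot_space A. proj A (\<phi> a) = f (proj A a)) \<and>
     (\<forall>x\<in>arrows X. linear_between (fibre A x) (fibre A (f x)) \<phi>) \<and>
     (\<forall>a\<in>tot_space A. bnorm A (\<phi> a) = bnorm A a) \<and>
     (\<forall>a\<in>tot_space A. \<forall>b\<in>tot_space A. src X (proj A a) = rng X (proj A b) \<longrightarrow>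
        \<phi> (fmul A a b) = fmul A (\<phi> a) (\<phi> b)) \<and>
     (\<forall>a\<in>tot_space A. \<phi> (fadj A a) = fadj A (\<phi> a))"

definition left_groupoid_action ::
  "('g, 'l) top_group_scheme \<Rightarrow> ('x, 'k) groupoid_scheme \<Rightarrow> ('g \<Rightarrow> 'x \<Rightarrow> 'x) \<Rightarrow> bool" where
  "left_groupoid_action G X \<alpha> \<longleftrightarrow>
     continuous_map (prod_topology (gr_top G) (gtop X)) (gtop X) (\<lambda>(s, x). \<alpha> s x) \<and>
     (\<forall>s\<in>carrier G. groupoid_automorphism X (\<alpha> s)) \<and>
     (\<forall>s\<in>carrier G. \<forall>t\<in>carrier G. \<forall>x\<in>arrows X. \<alpha> s (\<alpha> t x) = \<alpha> (s \<otimes>\<^bsub>G\<^esub> t) x)"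

definition right_groupoid_action ::
  "('h, 'l) top_group_scheme \<Rightarrow> ('x, 'k) groupoid_scheme \<Rightarrow> ('x \<Rightarrow> 'h \<Rightarrow> 'x) \<Rightarrow> bool" where
  "right_groupoid_action H X \<beta> \<longleftrightarrow>
     continuous_map (prod_topology (gtop X) (gr_top H)) (gtop X) (\<lambda>(x, h). \<beta> x h) \<and>
     (\<forall>h\<in>carrier H. groupoid_automorphism X (\<lambda>x. \<beta> x h)) \<and>
     (\<forall>h\<in>carrier H. \<forall>k\<in>carrier H. \<forall>x\<in>arrows X. \<beta> (\<beta> x h) k = \<beta> x (h \<otimes>\<^bsub>H\<^esub> k))"

definition left_fell_action ::
  "('g, 'l) top_group_scheme \<Rightarrow> ('x, 'k) groupoid_scheme \<Rightarrow> ('a, 'x, 'm) fell_scheme \<Rightarrow>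
   ('g \<Rightarrow> 'x \<Rightarrow> 'x) \<Rightarrow> ('g \<Rightarrow> 'a \<Rightarrow> 'a) \<Rightarrow> bool" where
  "left_fell_action G X A \<alpha>X \<alpha>A \<longleftrightarrow>
     left_groupoid_action G X \<alpha>X \<and>
     continuous_map (prod_topology (gr_top G) (btop A)) (btop A) (\<lambda>(s, a). \<alpha>A s a) \<and>
     (\<forall>s\<in>carrier G. fell_automorphism X A (\<alpha>X s) (\<alpha>A s)) \<and>
     (\<forall>s\<in>carrier G. \<forall>t\<in>carrier G. \<forall>a\<in>tot_space A. \<alpha>A s (\<alpha>A t a) = \<alpha>A (s \<otimes>\<^bsub>G\<^esub> t) a)"

definition right_fell_action ::
  "('h, 'l) top_group_scheme \<Rightarrow> ('x, 'k) groupoid_scheme \<Rightarrow> ('a, 'x, 'm) fell_scheme \<Rightarrow>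
   ('x \<Rightarrow> 'h \<Rightarrow> 'x) \<Rightarrow> ('a \<Rightarrow> 'h \<Rightarrow> 'a) \<Rightarrow> bool" where
  "right_fell_action H X A \<beta>X \<beta>A \<longleftrightarrow>
     right_groupoid_action H X \<beta>X \<and>
     continuous_map (prod_topology (btop A) (gr_top H)) (btop A) (\<lambda>(a, h). \<beta>A a h) \<and>
     (\<forall>h\<in>carrier H. fell_automorphism X A (\<lambda>x. \<beta>X x h) (\<lambda>a. \<beta>A a h)) \<and>
     (\<forall>h\<in>carrier H. \<forall>k\<in>carrier H. \<forall>a\<in>tot_space A. \<beta>A (\<beta>A a h) k = \<beta>A a (h \<otimes>\<^bsub>H\<^esub> k))"

definition free_left_action ::
  "('g, 'l) top_group_scheme \<Rightarrow> 'x topology \<Rightarrow> ('g \<Rightarrow> 'x \<Rightarrow> 'x) \<Rightarrow> bool" where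
  "free_left_action G T \<alpha> \<longleftrightarrow>
     (\<forall>s\<in>carrier G. \<forall>x\<in>topspace T. \<alpha> s x = x \<longrightarrow> s = \<one>\<^bsub>G\<^esub>)"

definition proper_left_action ::
  "('g, 'l) top_group_scheme \<Rightarrow> 'x topology \<Rightarrow> ('g \<Rightarrow> 'x \<Rightarrow> 'x) \<Rightarrow> bool" where
  "proper_left_action G T \<alpha> \<longleftrightarrow>
     proper_map (prod_topology (gr_top G) T) (prod_topology T T) (\<lambda>(s, x). (\<alpha> s x, x))"

definition free_right_action ::
  "('h, 'l) top_group_scheme \<Rightarrow> 'x topology \<Rightarrow> ('x \<Rightarrow> 'h \<Rightarrow> 'x) \<Rightarrow> bool" where
  "free_right_action H T \<beta> \<longleftrightarrow>
     (\<forall>h\<in>carrier H. \<forall>x\<in>topspace T. \<beta> x h = x \<longrightarrow> h = \<one>\<^bsub>H\<^esub>)"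

definition proper_right_action ::
  "('h, 'l) top_group_scheme \<Rightarrow> 'x topology \<Rightarrow> ('x \<Rightarrow> 'h \<Rightarrow> 'x) \<Rightarrow> bool" where
  "proper_right_action H T \<beta> \<longleftrightarrow>
     proper_map (prod_topology T (gr_top H)) (prod_topology T T) (\<lambda>(x, h). (\<beta> x h, x))"


section \<open>Orbit bundles\<close>

definition orb :: "('h, 'l) top_group_scheme \<Rightarrow> ('x \<Rightarrow> 'h \<Rightarrow> 'x) \<Rightarrow> 'x \<Rightarrow> 'x set" where
  "orb H \<beta> x = (\<lambda>h. \<beta> x h) ` carrier H"

definition quotient_top :: "'x topology \<Rightarrow> ('x \<Rightarrow> 'y) \<Rightarrow> 'y topology" where
  "quotient_top T q =
     topology (\<lambda>U. U \<subseteq> q ` topspace T \<and> openin T {x \<in> topspace T. q x \<in> U})"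

lemma istopology_quotient_top:
  "istopology (\<lambda>U. U \<subseteq> q ` topspace T \<and> openin T {x \<in> topspace T. q x \<in> U})"
proof -
  have 1: "{x \<in> topspace T. q x \<in> U \<inter> V} =
      {x \<in> topspace T. q x \<in> U} \<inter> {x \<in> topspace T. q x \<in> V}" for U V
    by auto
  have 2: "{x \<in> topspace T. q x \<in> \<Union>\<K>} = (\<Union>K\<in>\<K>. {x \<in> topspace T. q x \<in> K})" for \<K>
    by auto
  show ?thesis
    unfolding istopology_def
  proof (intro conjI allI impI)
    fix U V
    assume "U \<subseteq> q ` topspace T \<and> openin T {x \<in> topspace T. q x \<in> U}"
      and "V \<subseteq> q ` topspace T \<and> openin T {x \<in> topspace T. q x \<in> V}"
    then show "U \<inter> V \<subseteq> q ` topspace T" "openin T {x \<in> topspace T. q x \<in> U \<inter> V}"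
      unfolding 1 by (blast, blast intro: openin_Int)
  next
    fix \<K>
    assume "\<forall>K\<in>\<K>. K \<subseteq> q ` topspace T \<and> openin T {x \<in> topspace T. q x \<in> K}"
    then show "\<Union>\<K> \<subseteq> q ` topspace T" "openin T {x \<in> topspace T. q x \<in> \<Union>\<K>}"
      unfolding 2 by (blast, blast intro: openin_Union)
  qed
qed

lemma openin_quotient_top:
  "openin (quotient_top T q) U \<longleftrightarrow>
     U \<subseteq> q ` topspace T \<and> openin T {x \<in> topspace T. q x \<in> U}"
  by (simp only: quotient_top_def topology_inverse' [OF istopology_quotient_top])

lemma topspace_quotient_top: "topspace (quotient_top T q) = q ` topspace T"
proof
  show "topspace (quotient_top T q) \<subseteq> q ` topspace T"
    using openin_quotient_top [THEN iffD1, OF openin_topspace] by (rule conjunct1)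
  have "{x \<in> topspace T. q x \<in> q ` topspace T} = topspace T" by auto
  then have "openin (quotient_top T q) (q ` topspace T)"
    by (simp only: openin_quotient_top openin_topspace subset_refl simp_thms)
  then show "q ` topspace T \<subseteq> topspace (quotient_top T q)"
    by (rule openin_subset)
qed

lemma quotient_map_quotient_top: "quotient_map T (quotient_top T q) q"
  by (simp add: quotient_map_def topspace_quotient_top openin_quotient_top)

text \<open>
  The operations on orbits are given by their values on representatives; for a free action by
  automorphisms the result does not depend on the choice of (composable, respectively
  same-fibre) representatives.
\<close>

definition orbit_groupoid ::
  "('h, 'l) top_group_scheme \<Rightarrow> ('x, 'k) groupoid_scheme \<Rightarrow> ('x \<Rightarrow> 'h \<Rightarrow> 'x) \<Rightarrow> 'x set groupoid" where
  "orbit_groupoid H X \<beta> = \<lparr>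
     gtop = quotient_top (gtop X) (orb H \<beta>),
     rng = (\<lambda>c. THE d. \<exists>x\<in>c. d = orb H \<beta> (rng X x)),
     src = (\<lambda>c. THE d. \<exists>x\<in>c. d = orb H \<beta> (src X x)),
     gmul = (\<lambda>c c'. THE d. \<exists>x\<in>c. \<exists>y\<in>c'. src X x = rng X y \<and> d = orb H \<beta> (gmul X x y)),
     ginv = (\<lambda>c. THE d. \<exists>x\<in>c. d = orb H \<beta> (ginv X x))\<rparr>"

definition orbit_bundle ::
  "('h, 'l) top_group_scheme \<Rightarrow> ('x, 'k) groupoid_scheme \<Rightarrow> ('a, 'x, 'm) fell_scheme \<Rightarrow>
   ('x \<Rightarrow> 'h \<Rightarrow> 'x) \<Rightarrow> ('a \<Rightarrow> 'h \<Rightarrow> 'a) \<Rightarrow> ('a set, 'x set) fell" where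
  "orbit_bundle H X A \<beta>X \<beta>A = \<lparr>
     btop = quotient_top (btop A) (orb H \<beta>A),
     proj = (\<lambda>c. THE d. \<exists>a\<in>c. d = orb H \<beta>X (proj A a)),
     badd = (\<lambda>c c'. THE d. \<exists>a\<in>c. \<exists>b\<in>c'. proj A a = proj A b \<and> d = orb H \<beta>A (badd A a b)),
     bscl = (\<lambda>k c. THE d. \<exists>a\<in>c. d = orb H \<beta>A (bscl A k a)),
     bzero = (\<lambda>c. THE d. \<exists>x\<in>c. d = orb H \<beta>A (bzero A x)),
     bnorm = (\<lambda>c. THE n. \<exists>a\<in>c. n = bnorm A a),
     fmul = (\<lambda>c c'. THE d. \<exists>a\<in>c. \<exists>b\<in>c'.
        src X (proj A a) = rng X (proj A b) \<and> d = orb H \<beta>A (fmul A a b)),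
     fadj = (\<lambda>c. THE d. \<exists>a\<in>c. d = orb H \<beta>A (fadj A a))\<rparr>"

lemma right_action_one:
  assumes H: "group H" and act: "right_groupoid_action H X \<beta>" and x: "x \<in> arrows X"
  shows "\<beta> x \<one>\<^bsub>H\<^esub> = x"
proof -
  interpret group H by (rule H)
  have hom: "homeomorphic_map (gtop X) (gtop X) (\<lambda>x. \<beta> x \<one>\<^bsub>H\<^esub>)"
    using act by (auto simp: right_groupoid_action_def groupoid_automorphism_def)
  have inj: "inj_on (\<lambda>x. \<beta> x \<one>\<^bsub>H\<^esub>) (arrows X)" and img: "(\<lambda>x. \<beta> x \<one>\<^bsub>H\<^esub>) ` arrows X = arrows X"
    using hom by (simp_all add: homeomorphic_eq_everything_map)
  have "\<beta> (\<beta> x \<one>\<^bsub>H\<^esub>) \<one>\<^bsub>H\<^esub> = \<beta> x \<one>\<^bsub>H\<^esub>"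
    using act x by (simp add: right_groupoid_action_def)
  then show ?thesis
    using inj img x by (metis image_eqI inj_onD)
qed

lemma orb_eqI:
  assumes H: "group H" and h: "h \<in> carrier H"
    and assoc: "\<And>k. k \<in> carrier H \<Longrightarrow> \<beta> (\<beta> x h) k = \<beta> x (h \<otimes>\<^bsub>H\<^esub> k)"
  shows "orb H \<beta> (\<beta> x h) = orb H \<beta> x"
proof -
  interpret group H by (rule H)
  have "\<beta> x k \<in> orb H \<beta> (\<beta> x h)" if "k \<in> carrier H" for k
  proof -
    have "h \<otimes>\<^bsub>H\<^esub> (inv\<^bsub>H\<^esub> h \<otimes>\<^bsub>H\<^esub> k) = k"
      using h that by (simp add: m_assoc [symmetric])
    then have "\<beta> x k = \<beta> (\<beta> x h) (inv\<^bsub>H\<^esub> h \<otimes>\<^bsub>H\<^esub> k)"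
      using assoc [of "inv\<^bsub>H\<^esub> h \<otimes>\<^bsub>H\<^esub> k"] h that by simp
    then show ?thesis
      using h that by (auto simp: orb_def)
  qed
  moreover have "\<beta> (\<beta> x h) k \<in> orb H \<beta> x" if "k \<in> carrier H" for k
    using assoc [OF that] h that by (auto simp: orb_def)
  ultimately show ?thesis
    by (auto simp: orb_def)
qed

lemma gmul_orbit_groupoid:
  assumes H: "group H" and act: "right_groupoid_action H X \<beta>" and free: "free_right_action H (gtop X) \<beta>"
    and X: "algebraic_groupoid X"
    and xy: "x \<in> arrows X" "y \<in> arrows X" "src X x = rng X y"
  shows "gmul (orbit_groupoid H X \<beta>) (orb H \<beta> x) (orb H \<beta> y) = orb H \<beta> (gmul X x y)"
proof -
  interpret group H by (rule H)
  have assoc: "\<beta> (\<beta> z h) k = \<beta> z (h \<otimes>\<^bsub>H\<^esub> k)" if "h \<in> carrier H" "k \<in> carrier H" "z \<in> arrows X" for z h k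
    using act that by (simp add: right_groupoid_action_def)
  have auto: "rng X (\<beta> z h) = \<beta> (rng X z) h \<and> src X (\<beta> z h) = \<beta> (src X z) h"
    if "h \<in> carrier H" "z \<in> arrows X" for z h
    using act that by (auto simp: right_groupoid_action_def groupoid_automorphism_def)
  have mul: "\<beta> (gmul X z w) h = gmul X (\<beta> z h) (\<beta> w h)"
    if "h \<in> carrier H" "z \<in> arrows X" "w \<in> arrows X" "src X z = rng X w" for z w h
    using act that by (auto simp: right_groupoid_action_def groupoid_automorphism_def)
  have arr: "gmul X x y \<in> arrows X" and u: "src X x \<in> arrows X"
    using X xy by (auto simp: algebraic_groupoid_def)
  have eq: "h = k" if "h \<in> carrier H" "k \<in> carrier H" "\<beta> (src X x) h = \<beta> (src X x) k" for h k
  proof -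
    have "\<beta> (src X x) (h \<otimes>\<^bsub>H\<^esub> inv\<^bsub>H\<^esub> k) = \<beta> (src X x) (k \<otimes>\<^bsub>H\<^esub> inv\<^bsub>H\<^esub> k)"
      using that u assoc by (metis inv_closed)
    then have "\<beta> (src X x) (h \<otimes>\<^bsub>H\<^esub> inv\<^bsub>H\<^esub> k) = src X x"
      using that u right_action_one [OF H act u] by simp
    then have "h \<otimes>\<^bsub>H\<^esub> inv\<^bsub>H\<^esub> k = \<one>\<^bsub>H\<^esub>"
      using free that u unfolding free_right_action_def by (metis inv_closed m_closed)
    then show ?thesis
      using that by (metis inv_equality inv_inv inv_closed)
  qed
  have "(THE d. \<exists>x'\<in>orb H \<beta> x. \<exists>y'\<in>orb H \<beta> y. src X x' = rng X y' \<and> d = orb H \<beta> (gmul X x' y'))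
      = orb H \<beta> (gmul X x y)"
  proof (rule the_equality)
    have "x \<in> orb H \<beta> x" "y \<in> orb H \<beta> y"
      using right_action_one [OF H act] xy one_closed by (metis image_eqI orb_def)+
    then show "\<exists>x'\<in>orb H \<beta> x. \<exists>y'\<in>orb H \<beta> y.
        src X x' = rng X y' \<and> orb H \<beta> (gmul X x y) = orb H \<beta> (gmul X x' y')"
      using xy by blast
  next
    fix d
    assume "\<exists>x'\<in>orb H \<beta> x. \<exists>y'\<in>orb H \<beta> y. src X x' = rng X y' \<and> d = orb H \<beta> (gmul X x' y')"
    then obtain h k where hk: "h \<in> carrier H" "k \<in> carrier H"
      "src X (\<beta> x h) = rng X (\<beta> y k)" "d = orb H \<beta> (gmul X (\<beta> x h) (\<beta> y k))"
      by (auto simp: orb_def)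
    have "\<beta> (src X x) h = \<beta> (src X x) k"
      using hk(3) auto [OF hk(1) xy(1)] auto [OF hk(2) xy(2)] xy(3) by metis
    then have "h = k"
      by (rule eq [OF hk(1,2)])
    then have "d = orb H \<beta> (\<beta> (gmul X x y) h)"
      using hk(4) mul [OF hk(1) xy] by simp
    also have "\<dots> = orb H \<beta> (gmul X x y)"
      by (rule orb_eqI [OF H hk(1)]) (rule assoc [OF hk(1) _ arr])
    finally show "d = orb H \<beta> (gmul X x y)" .
  qed
  then show ?thesis
    by (simp add: orbit_groupoid_def)
qed


section \<open>Semidirect products\<close>

definition semidirect_groupoid ::
  "('g, 'l) top_group_scheme \<Rightarrow> ('z, 'k) groupoid_scheme \<Rightarrow> ('g \<Rightarrow> 'z \<Rightarrow> 'z) \<Rightarrow> ('z \<times> 'g) groupoid"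
  where
  "semidirect_groupoid G Z \<alpha> = \<lparr>
     gtop = prod_topology (gtop Z) (gr_top G),
     rng = (\<lambda>(x, t). (rng Z x, \<one>\<^bsub>G\<^esub>)),
     src = (\<lambda>(x, t). (\<alpha> (inv\<^bsub>G\<^esub> t) (src Z x), \<one>\<^bsub>G\<^esub>)),
     gmul = (\<lambda>(x, s) (y, t). (gmul Z x (\<alpha> s y), s \<otimes>\<^bsub>G\<^esub> t)),
     ginv = (\<lambda>(x, s). (\<alpha> (inv\<^bsub>G\<^esub> s) (ginv Z x), inv\<^bsub>G\<^esub> s))\<rparr>"

definition semidirect_bundle ::
  "('g, 'l) top_group_scheme \<Rightarrow> ('c, 'z, 'm) fell_scheme \<Rightarrow> ('g \<Rightarrow> 'c \<Rightarrow> 'c) \<Rightarrow>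
   ('c \<times> 'g, 'z \<times> 'g) fell" where
  "semidirect_bundle G C \<alpha> = \<lparr>
     btop = prod_topology (btop C) (gr_top G),
     proj = (\<lambda>(a, s). (proj C a, s)),
     badd = (\<lambda>(a, s) (b, t). (badd C a b, s)),
     bscl = (\<lambda>k (a, s). (bscl C k a, s)),
     bzero = (\<lambda>(x, s). (bzero C x, s)),
     bnorm = (\<lambda>(a, s). bnorm C a),
     fmul = (\<lambda>(a, s) (b, t). (fmul C a (\<alpha> s b), s \<otimes>\<^bsub>G\<^esub> t)),
     fadj = (\<lambda>(a, s). (\<alpha> (inv\<^bsub>G\<^esub> s) (fadj C a), inv\<^bsub>G\<^esub> s))\<rparr>"


section \<open>Actions of groupoids on spaces and of Fell bundles on Banach bundles\<close>

definition groupoid_space_action ::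
  "('z, 'k) groupoid_scheme \<Rightarrow> 'w topology \<Rightarrow> ('w \<Rightarrow> 'z) \<Rightarrow> ('z \<Rightarrow> 'w \<Rightarrow> 'w) \<Rightarrow> bool" where
  "groupoid_space_action Z \<Omega> \<rho> m \<longleftrightarrow>
     continuous_map \<Omega> (subtopology (gtop Z) (units Z)) \<rho> \<and>
     open_map \<Omega> (subtopology (gtop Z) (units Z)) \<rho> \<and>
     continuous_map (subtopology (prod_topology (gtop Z) \<Omega>) {(z, u). src Z z = \<rho> u}) \<Omega>
       (\<lambda>(z, u). m z u) \<and>
     (\<forall>z\<in>arrows Z. \<forall>u\<in>topspace \<Omega>. src Z z = \<rho> u \<longrightarrow> \<rho> (m z u) = rng Z z) \<and>
     (\<forall>z\<in>arrows Z. \<forall>w\<in>arrows Z. \<forall>u\<in>topspace \<Omega>. src Z z = rng Z w \<and> src Z w = \<rho> u \<longrightarrow>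
        m (gmul Z z w) u = m z (m w u)) \<and>
     (\<forall>u\<in>topspace \<Omega>. m (\<rho> u) u = u)"

definition fell_bundle_action ::
  "('z, 'k) groupoid_scheme \<Rightarrow> ('c, 'z, 'm) fell_scheme \<Rightarrow> 'w topology \<Rightarrow>
   ('e, 'w, 'n) bbundle_scheme \<Rightarrow> ('w \<Rightarrow> 'z) \<Rightarrow> ('z \<Rightarrow> 'w \<Rightarrow> 'w) \<Rightarrow> ('c \<Rightarrow> 'e \<Rightarrow> 'e) \<Rightarrow> bool" where
  "fell_bundle_action Z C \<Omega> E \<rho> m \<mu> \<longleftrightarrow>
     groupoid_space_action Z \<Omega> \<rho> m \<and>
     continuous_map
       (subtopology (prod_topology (btop C) (btop E)) {(c, e). src Z (proj C c) = \<rho> (proj E e)})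
       (btop E) (\<lambda>(c, e). \<mu> c e) \<and>
     (\<forall>z\<in>arrows Z. \<forall>w\<in>topspace \<Omega>. src Z z = \<rho> w \<longrightarrow>
        bilinear_between (fibre C z) (fibre E w) (fibre E (m z w)) \<mu>) \<and>
     (\<forall>c\<in>tot_space C. \<forall>d\<in>tot_space C. \<forall>e\<in>tot_space E.
        src Z (proj C c) = rng Z (proj C d) \<and> src Z (proj C d) = \<rho> (proj E e) \<longrightarrow>
        \<mu> c (\<mu> d e) = \<mu> (fmul C c d) e) \<and>
     (\<forall>c\<in>tot_space C. \<forall>e\<in>tot_space E. src Z (proj C c) = \<rho> (proj E e) \<longrightarrow>
        bnorm E (\<mu> c e) \<le> bnorm C c * bnorm E e)"

end

theory Submission
  imports Defs
begin

text \<open>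
  Both actions are given by formulas on representatives. For the action of \<open>G\<close> on orbits nothing has
  to be chosen: the actions commute, so \<open>\<alpha> s\<close> maps each \<open>H\<close>-orbit onto an \<open>H\<close>-orbit, and the action is
  the direct image. Its joint continuity uses that the orbit map is open, so that its product with
  an identity map is again a quotient map (\<open>continuous_map_on_orbits\<close>).

  For the action of the semidirect product a representative has to be chosen: \<open>(a H, t) b\<close> is
  \<open>a (t b)\<close> for that \<open>a\<close> in the orbit with \<open>s(a) = r(t b)\<close>. It exists because the orbits of the two units
  agree, and it is unique because the action of \<open>H\<close> on units is free. The analytic content of part
  (ii) is that this choice, \<open>lift\<close> below, is continuous in the orbit and the unit. This is where
  properness enters: \<open>(x, h) \<mapsto> (x h, x)\<close> is a closed injection, so the translation map
  \<open>(x h, x) \<mapsto> h\<close> is continuous (\<open>translation_continuous\<close>), and \<open>lift\<close> moves an arbitrary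
  representative by a value of the translation map (\<open>lift_continuous\<close>). The algebraic laws are then
  computations with matching representatives.

  Two ingredients are independent of the group actions. The fibring map is open because the range
  map of a groupoid with a Haar system is open (\<open>haar_system_imp_open_rng\<close>). The estimate
  \<open>\<parallel>c e\<parallel> \<le> \<parallel>c\<parallel> \<parallel>e\<parallel>\<close> comes from \<open>\<parallel>a b\<parallel> \<le> \<parallel>a\<parallel> \<parallel>b\<parallel>\<close> in the Fell bundle, which is an axiom only when \<open>a\<close>
  and \<open>b\<close> lie in one unit fibre; in general it is derived from the C*-identity (\<open>norm_fmul\<close>).
\<close>

section \<open>Orbit spaces of continuous group actions\<close>

lemma continuous_map_compose_pair:
  assumes "continuous_map Z T f" "continuous_map Z T' g"
    and "continuous_map (subtopology (prod_topology T T') D) Y (\<lambda>(a, b). F a b)"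
    and "\<And>z. z \<in> topspace Z \<Longrightarrow> (f z, g z) \<in> D"
  shows "continuous_map Z Y (\<lambda>z. F (f z) (g z))"
proof -
  have "continuous_map Z (subtopology (prod_topology T T') D) (\<lambda>z. (f z, g z))"
    using assms by (auto simp: continuous_map_in_subtopology continuous_map_paired)
  from continuous_map_compose [OF this assms(3)] show ?thesis
    by (simp add: o_def)
qed

lemma continuous_map_compose_pair_total:
  assumes "continuous_map Z T f" "continuous_map Z T' g"
    and "continuous_map (prod_topology T T') Y (\<lambda>(a, b). F a b)"
  shows "continuous_map Z Y (\<lambda>z. F (f z) (g z))"
  using continuous_map_compose_pair [of Z T f T' g UNIV Y F] assms by simp

lemma open_map_prod:
  assumes "open_map S S' f" "open_map T T' g"
  shows "open_map (prod_topology S T) (prod_topology S' T') (\<lambda>(x, y). (f x, g y))"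
  unfolding open_map_def
proof (intro allI impI)
  fix W assume W: "openin (prod_topology S T) W"
  show "openin (prod_topology S' T') ((\<lambda>(x, y). (f x, g y)) ` W)"
    unfolding openin_prod_topology_alt
  proof (intro allI impI)
    fix a b assume "(a, b) \<in> (\<lambda>(x, y). (f x, g y)) ` W"
    then obtain x y where xy: "(x, y) \<in> W" "a = f x" "b = g y" by auto
    then obtain U V where UV: "openin S U" "openin T V" "x \<in> U" "y \<in> V" "U \<times> V \<subseteq> W"
      using W unfolding openin_prod_topology_alt by meson
    then have "openin S' (f ` U)" "openin T' (g ` V)"
      using assms by (auto simp: open_map_def)
    moreover have "a \<in> f ` U" "b \<in> g ` V" "f ` U \<times> g ` V \<subseteq> (\<lambda>(x, y). (f x, g y)) ` W"
      using UV xy by force+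
    ultimately show "\<exists>U V. openin S' U \<and> openin T' V \<and> a \<in> U \<and> b \<in> V \<and>
        U \<times> V \<subseteq> (\<lambda>(x, y). (f x, g y)) ` W"
      by blast
  qed
qed

locale right_action = group H for H :: "('h, 'l) top_group_scheme" (structure) +
  fixes T :: "'s topology" and \<beta> :: "'s \<Rightarrow> 'h \<Rightarrow> 's"
  assumes group_top: "topspace (gr_top H) = carrier H"
    and act_continuous: "continuous_map (prod_topology T (gr_top H)) T (\<lambda>(x, h). \<beta> x h)"
    and act_assoc: "\<lbrakk>x \<in> topspace T; h \<in> carrier H; k \<in> carrier H\<rbrakk> \<Longrightarrow> \<beta> (\<beta> x h) k = \<beta> x (h \<otimes> k)"
    and act_one: "x \<in> topspace T \<Longrightarrow> \<beta> x \<one> = x"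
begin

abbreviation orbs :: "'s set topology" where
  "orbs \<equiv> quotient_top T (orb H \<beta>)"

lemma act_closed: "\<lbrakk>x \<in> topspace T; h \<in> carrier H\<rbrakk> \<Longrightarrow> \<beta> x h \<in> topspace T"
  using continuous_map_funspace [OF act_continuous] group_top by (auto simp: Pi_iff)

lemma orb_self: "x \<in> topspace T \<Longrightarrow> x \<in> orb H \<beta> x"
  using act_one one_closed by (metis image_eqI orb_def)

lemma orb_act: "\<lbrakk>x \<in> topspace T; h \<in> carrier H\<rbrakk> \<Longrightarrow> orb H \<beta> (\<beta> x h) = orb H \<beta> x"
  by (rule orb_eqI [OF is_group]) (auto simp: act_assoc)

lemma orb_eqD:
  assumes "x \<in> topspace T" "y \<in> topspace T" "orb H \<beta> x = orb H \<beta> y"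
  obtains h where "h \<in> carrier H" "y = \<beta> x h"
proof -
  have "y \<in> orb H \<beta> x"
    using orb_self [OF assms(2)] assms(3) by simp
  then show ?thesis
    using that by (auto simp: orb_def)
qed

lemma orbs_E:
  assumes "c \<in> topspace orbs"
  obtains x where "x \<in> topspace T" "c = orb H \<beta> x"
  using assms by (auto simp: topspace_quotient_top)

lemma orb_in_orbs: "x \<in> topspace T \<Longrightarrow> orb H \<beta> x \<in> topspace orbs"
  by (auto simp: topspace_quotient_top)

lemma orb_continuous: "continuous_map T orbs (orb H \<beta>)"
  by (rule quotient_imp_continuous_map [OF quotient_map_quotient_top])

lemma translate_continuous: "h \<in> carrier H \<Longrightarrow> continuous_map T T (\<lambda>x. \<beta> x h)"
  by (rule continuous_map_compose_pair_total [OF _ _ act_continuous]) (auto simp: group_top)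

text \<open>The saturation of an open set \<open>U\<close> is the union of its translates, hence open.\<close>

lemma orb_open: "open_map T orbs (orb H \<beta>)"
  unfolding open_map_def openin_quotient_top
proof (intro allI impI conjI)
  fix U assume U: "openin T U"
  then have sub: "U \<subseteq> topspace T" by (rule openin_subset)
  then show "orb H \<beta> ` U \<subseteq> orb H \<beta> ` topspace T" by blast
  have "{x \<in> topspace T. orb H \<beta> x \<in> orb H \<beta> ` U} = (\<Union>h\<in>carrier H. {x \<in> topspace T. \<beta> x h \<in> U})"
    (is "?L = ?R")
  proof
    show "?R \<subseteq> ?L"
      using orb_act by (auto simp: image_iff)
    show "?L \<subseteq> ?R"
    proof
      fix x assume "x \<in> ?L"
      then obtain y where "x \<in> topspace T" "y \<in> U" "orb H \<beta> x = orb H \<beta> y" by auto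
      then show "x \<in> ?R"
        using sub by (auto elim!: orb_eqD [of x y])
    qed
  qed
  moreover have "openin T {x \<in> topspace T. \<beta> x h \<in> U}" if "h \<in> carrier H" for h
    using openin_continuous_map_preimage [OF translate_continuous [OF that] U] .
  ultimately show "openin T {x \<in> topspace T. orb H \<beta> x \<in> orb H \<beta> ` U}"
    by auto
qed

text \<open>
  A product of quotient maps need not be a quotient map, nor does the restriction of a quotient
  map to a saturated subset; for the open map onto the orbit space both are.
\<close>

lemma continuous_map_on_orbits:
  assumes "continuous_map (subtopology (prod_topology T W) {(x, w). (orb H \<beta> x, w) \<in> D}) Y
    (\<lambda>(x, w). f (orb H \<beta> x) w)"
  shows "continuous_map (subtopology (prod_topology orbs W) D) Y (\<lambda>(c, w). f c w)"
proof -
  let ?q = "\<lambda>(x, w). (orb H \<beta> x, w)"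
  let ?D = "{z \<in> topspace (prod_topology T W). ?q z \<in> D}"
  have "continuous_map (prod_topology T W) (prod_topology orbs W) ?q"
    using continuous_map_compose [OF continuous_map_fst orb_continuous, of W]
      continuous_map_snd [of T W]
    by (auto simp: case_prod_unfold continuous_map_paired o_def)
  then have "continuous_map (subtopology (prod_topology T W) ?D) (subtopology (prod_topology orbs W) D) ?q"
    by (auto simp: continuous_map_in_subtopology continuous_map_from_subtopology)
  moreover have "open_map (subtopology (prod_topology T W) ?D) (subtopology (prod_topology orbs W) D) ?q"
    using open_map_restriction [OF open_map_prod [OF orb_open open_map_id [of W]], of D ?D]
    by (simp add: id_def)
  moreover have "?q ` topspace (subtopology (prod_topology T W) ?D)
      = topspace (subtopology (prod_topology orbs W) D)"
    by (force simp: topspace_quotient_top)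
  ultimately have "quotient_map (subtopology (prod_topology T W) ?D) (subtopology (prod_topology orbs W) D) ?q"
    by (rule continuous_open_imp_quotient_map)
  moreover have "?D = topspace (prod_topology T W) \<inter> {(x, w). (orb H \<beta> x, w) \<in> D}"
    by auto
  then have "continuous_map (subtopology (prod_topology T W) ?D) Y ((\<lambda>(c, w). f c w) \<circ> ?q)"
    using assms by (simp only: subtopology_restrict) (simp add: o_def case_prod_unfold)
  ultimately show ?thesis
    by (rule continuous_compose_quotient_map)
qed

lemma the_orb:
  assumes "x \<in> topspace T" "\<And>h. h \<in> carrier H \<Longrightarrow> f (\<beta> x h) = f x"
  shows "(THE d. \<exists>y\<in>orb H \<beta> x. d = f y) = f x"
  using assms orb_self [OF assms(1)] by (intro the_equality) (auto simp: orb_def)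

end

lemma image_orb:
  assumes "\<And>h. h \<in> carrier H \<Longrightarrow> f (\<beta> x h) = \<beta>' (f x) h"
  shows "f ` orb H \<beta> x = orb H \<beta>' (f x)"
  using assms by (force simp: orb_def)

locale free_proper_right_action = right_action +
  assumes free: "free_right_action H T \<beta>"
    and proper: "proper_right_action H T \<beta>"
begin

lemma act_eq_self: "\<lbrakk>x \<in> topspace T; h \<in> carrier H; \<beta> x h = x\<rbrakk> \<Longrightarrow> h = \<one>"
  using free by (auto simp: free_right_action_def)

lemma act_inj:
  assumes x: "x \<in> topspace T" and hk: "h \<in> carrier H" "k \<in> carrier H" and eq: "\<beta> x h = \<beta> x k"
  shows "h = k"
proof -
  have "\<beta> x (h \<otimes> inv k) = \<beta> x (k \<otimes> inv k)"
    using act_assoc x hk eq by (metis inv_closed)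
  then have "h \<otimes> inv k = \<one>"
    using act_one x hk act_eq_self by simp
  then show ?thesis
    using hk by (metis inv_equality inv_inv inv_closed)
qed

definition translation where
  "translation y x = (THE h. h \<in> carrier H \<and> y = \<beta> x h)"

lemma translation_act: "\<lbrakk>x \<in> topspace T; h \<in> carrier H\<rbrakk> \<Longrightarrow> translation (\<beta> x h) x = h"
  unfolding translation_def using act_inj by blast

text \<open>
  By freeness the map \<open>(x, h) \<mapsto> (\<beta> x h, x)\<close> is injective, by properness it is closed; so it is a
  homeomorphism onto its image, and the translation map is a component of its inverse.
\<close>

lemma translation_continuous:
  "continuous_map (subtopology (prod_topology T T) {(y, x). orb H \<beta> y = orb H \<beta> x}) (gr_top H)
     (\<lambda>(y, x). translation y x)"
proof -
  let ?f = "\<lambda>(x, h). (\<beta> x h, x)"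
  let ?P = "prod_topology T (gr_top H)"
  let ?R = "{(y, x). orb H \<beta> y = orb H \<beta> x}"
  have "continuous_map ?P (prod_topology T T) ?f"
    using act_continuous by (simp add: case_prod_unfold continuous_map_paired continuous_map_fst)
  moreover have "closed_map ?P (prod_topology T T) ?f"
    using proper unfolding proper_right_action_def by (rule proper_imp_closed_map)
  moreover have "inj_on ?f (topspace ?P)"
    using act_inj by (auto simp: inj_on_def group_top)
  ultimately have "embedding_map ?P (prod_topology T T) ?f"
    by (rule injective_closed_imp_embedding_map)
  then obtain g where g: "homeomorphic_maps ?P (subtopology (prod_topology T T) (?f ` topspace ?P)) ?f g"
    by (auto simp: embedding_map_def homeomorphic_map_maps)
  have "?f ` topspace ?P = topspace (prod_topology T T) \<inter> ?R"
  proof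
    show "?f ` topspace ?P \<subseteq> topspace (prod_topology T T) \<inter> ?R"
      using act_closed orb_act by (auto simp: group_top)
    show "topspace (prod_topology T T) \<inter> ?R \<subseteq> ?f ` topspace ?P"
    proof
      fix z assume "z \<in> topspace (prod_topology T T) \<inter> ?R"
      then obtain y x where z: "z = (y, x)" "y \<in> topspace T" "x \<in> topspace T" "orb H \<beta> x = orb H \<beta> y"
        by auto
      then obtain h where "h \<in> carrier H" "y = \<beta> x h"
        by (metis orb_eqD)
      then show "z \<in> ?f ` topspace ?P"
        using z by (intro image_eqI [of _ _ "(x, h)"]) (auto simp: group_top)
    qed
  qed
  then have sub: "subtopology (prod_topology T T) (?f ` topspace ?P) = subtopology (prod_topology T T) ?R"
    by (metis subtopology_restrict)
  have g_eq: "snd (g z) = (case z of (y, x) \<Rightarrow> translation y x)"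
    if "z \<in> topspace (subtopology (prod_topology T T) ?R)" for z
  proof -
    have "?f (g z) = z" "g z \<in> topspace ?P"
      using g that continuous_map_funspace unfolding homeomorphic_maps_def sub by fastforce+
    then show ?thesis
      using translation_act by (cases "g z") (auto simp: group_top)
  qed
  have "continuous_map (subtopology (prod_topology T T) ?R) (gr_top H) (snd \<circ> g)"
    using g unfolding homeomorphic_maps_def sub
    by (meson continuous_map_compose continuous_map_snd)
  then show ?thesis
    by (rule continuous_map_eq) (simp only: o_apply g_eq)
qed

end

text \<open>
  The range and source maps of the groupoid, the bundle projection, and its composition
  with the source map are the maps of this kind that occur below.
\<close>

locale equivariant_map =
  S: right_action H S \<beta>S + T: free_proper_right_action H T \<beta>
  for H (structure) and S \<beta>S and T \<beta> +
  fixes \<sigma>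
  assumes sigma_continuous: "continuous_map S T \<sigma>"
    and sigma_act: "\<lbrakk>a \<in> topspace S; h \<in> carrier H\<rbrakk> \<Longrightarrow> \<sigma> (\<beta>S a h) = \<beta> (\<sigma> a) h"
begin

lemma sigma_closed: "a \<in> topspace S \<Longrightarrow> \<sigma> a \<in> topspace T"
  using sigma_continuous by (auto simp: continuous_map_def)

text \<open>A point of the orbit \<open>c\<close> is determined by its image under \<open>\<sigma>\<close>, since \<open>H\<close> acts freely there.\<close>

definition lift where
  "lift c w = (THE a. a \<in> c \<and> \<sigma> a = w)"

lemma lift_orb_act:
  assumes a: "a \<in> topspace S" and h: "h \<in> carrier H"
  shows "lift (orb H \<beta>S a) (\<beta> (\<sigma> a) h) = \<beta>S a h"
  unfolding lift_def
proof (rule the_equality)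
  show "\<beta>S a h \<in> orb H \<beta>S a \<and> \<sigma> (\<beta>S a h) = \<beta> (\<sigma> a) h"
    using a h sigma_act by (auto simp: orb_def)
next
  fix b assume "b \<in> orb H \<beta>S a \<and> \<sigma> b = \<beta> (\<sigma> a) h"
  then obtain k where k: "k \<in> carrier H" "b = \<beta>S a k" "\<beta> (\<sigma> a) k = \<beta> (\<sigma> a) h"
    using a sigma_act by (auto simp: orb_def)
  then show "b = \<beta>S a h"
    using T.act_inj [OF sigma_closed [OF a] k(1) h k(3)] by simp
qed

lemma lift_orb: "a \<in> topspace S \<Longrightarrow> lift (orb H \<beta>S a) (\<sigma> a) = a"
  using lift_orb_act [of a \<one>] S.act_one T.act_one sigma_closed by simp

lemma orb_sigma_eqE:
  assumes c: "c \<in> topspace S.orbs" and w: "w \<in> topspace T"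
    and eq: "\<And>a. a \<in> topspace S \<Longrightarrow> c = orb H \<beta>S a \<Longrightarrow> orb H \<beta> (\<sigma> a) = orb H \<beta> w"
  obtains a where "a \<in> topspace S" "c = orb H \<beta>S a" "\<sigma> a = w"
proof -
  obtain a where a: "a \<in> topspace S" "c = orb H \<beta>S a"
    using c by (rule S.orbs_E)
  then obtain h where "h \<in> carrier H" "w = \<beta> (\<sigma> a) h"
    using T.orb_eqD [OF sigma_closed w eq] by blast
  then show ?thesis
    using that [of "\<beta>S a h"] a S.act_closed S.orb_act sigma_act by simp
qed

lemma same_orb_eqI:
  assumes "a \<in> topspace S" "b \<in> topspace S" "orb H \<beta>S a = orb H \<beta>S b" "\<sigma> a = \<sigma> b"
  shows "a = b"
  using assms lift_orb by metis

text \<open>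
  Over \<open>S\<close> instead of its orbit space the lift is \<open>(a, w) \<mapsto> a h\<close>, where \<open>h\<close> translates \<open>\<sigma> a\<close> to \<open>w\<close>;
  this is continuous and depends on \<open>a\<close> only through its orbit.
\<close>

lemma lift_continuous:
  assumes "\<And>a w. \<lbrakk>a \<in> topspace S; w \<in> topspace T; (orb H \<beta>S a, w) \<in> D\<rbrakk> \<Longrightarrow> orb H \<beta> w = orb H \<beta> (\<sigma> a)"
  shows "continuous_map (subtopology (prod_topology S.orbs T) D) S (\<lambda>(c, w). lift c w)"
proof (rule S.continuous_map_on_orbits)
  let ?P = "subtopology (prod_topology S T) {(a, w). (orb H \<beta>S a, w) \<in> D}"
  have fst: "continuous_map ?P S fst" and snd: "continuous_map ?P T snd"
    by (auto intro: continuous_map_from_subtopology continuous_map_fst continuous_map_snd)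
  have "continuous_map ?P (gr_top H) (\<lambda>z. T.translation (snd z) (\<sigma> (fst z)))"
    using continuous_map_compose [OF fst sigma_continuous] assms
    by (intro continuous_map_compose_pair [OF snd _ T.translation_continuous]) (auto simp: o_def)
  then have "continuous_map ?P S (\<lambda>z. \<beta>S (fst z) (T.translation (snd z) (\<sigma> (fst z))))"
    by (rule continuous_map_compose_pair_total [OF fst _ S.act_continuous])
  then show "continuous_map ?P S (\<lambda>(a, w). lift (orb H \<beta>S a) w)"
  proof (rule continuous_map_eq)
    fix z assume "z \<in> topspace ?P"
    then obtain a w where z: "z = (a, w)" "a \<in> topspace S" "w \<in> topspace T" "(orb H \<beta>S a, w) \<in> D"
      by auto
    then obtain h where h: "h \<in> carrier H" "w = \<beta> (\<sigma> a) h"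
      using T.orb_eqD [OF sigma_closed _ assms [symmetric]] by blast
    then show "\<beta>S (fst z) (T.translation (snd z) (\<sigma> (fst z))) = (\<lambda>(a, w). lift (orb H \<beta>S a) w) z"
      using z lift_orb_act T.translation_act sigma_closed by simp
  qed
qed

end

section \<open>A Haar system makes the range map open\<close>

lemma locally_compact_bump:
  assumes lc: "lchs_space T" and U: "openin T U" "x \<in> U"
  obtains f :: "'x \<Rightarrow> real" where "continuous_map T euclideanreal f" "\<And>y. 0 \<le> f y" "\<And>y. f y \<le> 1" "f x = 1"
    "cc_function T (\<lambda>y. complex_of_real (f y))" "\<And>y. y \<in> topspace T - U \<Longrightarrow> f y = 0"
proof -
  have T: "locally_compact_space T" "Hausdorff_space T" "regular_space T" "completely_regular_space T"
    using lc locally_compact_Hausdorff_imp_regular_space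
      locally_compact_regular_imp_completely_regular_space
    by (auto simp: lchs_space_def)
  then obtain V K where VK: "openin T V" "compactin T K" "x \<in> V" "V \<subseteq> K" "K \<subseteq> U"
    using U by (metis locally_compact_space_neighbourhood_base neighbourhood_base_of)
  have "x \<in> topspace T - (topspace T - V)" "closedin T (topspace T - V)"
    using VK openin_subset by blast+
  then obtain g :: "'x \<Rightarrow> real" where g: "continuous_map T (top_of_set {0..1}) g" "g x = 0" "g ` (topspace T - V) \<subseteq> {1}"
    using T(4) unfolding completely_regular_space_def by metis
  \<comment> \<open>The values of \<open>g\<close> outside the space are arbitrary; clamping makes the bounds on \<open>f\<close> hold everywhere.\<close>
  define f where "f y = max 0 (min 1 (1 - g y))" for y
  have "continuous_map T euclideanreal g"
    using g(1) by (simp add: continuous_map_in_subtopology)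
  then have f: "continuous_map T euclideanreal f"
    unfolding f_def by (intro continuous_intros) auto
  have zero: "f y = 0" if "y \<in> topspace T - K" for y
    using g(3) that VK(4) by (force simp: f_def)
  have "continuous_map T euclidean (\<lambda>y. complex_of_real (f y))"
    using continuous_map_compose [OF f, of euclidean complex_of_real] continuous_on_of_real_id
    by (simp add: o_def)
  then have "cc_function T (\<lambda>y. complex_of_real (f y))"
    using VK(2) zero unfolding cc_function_def by auto
  then show ?thesis
    using f zero g(2) VK(5) by (intro that [of f]) (auto simp: f_def)
qed

text \<open>
  If \<open>f\<close> is a bump function at \<open>x\<close> supported in \<open>U\<close>, then \<open>u \<mapsto> \<integral> f d(\<nu> u)\<close> is continuous, it is
  positive at \<open>u = r(x)\<close> because \<open>\<nu> u\<close> has full support on the arrows with range \<open>u\<close>, and where it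
  does not vanish some arrow in \<open>U\<close> has range \<open>u\<close>.
\<close>

lemma haar_system_imp_open_rng:
  assumes X: "lchs_space (gtop X)" and units: "\<And>x. x \<in> arrows X \<Longrightarrow> rng X x \<in> units X"
    and rng: "continuous_map (gtop X) (gtop X) (rng X)" and \<nu>: "left_haar_system X \<nu>"
  shows "open_map (gtop X) (subtopology (gtop X) (units X)) (rng X)"
  unfolding open_map_def
proof (intro allI impI)
  fix U assume U: "openin (gtop X) U"
  then have sub: "U \<subseteq> arrows X" by (rule openin_subset)
  have haar: "space (\<nu> u) = arrows X" "sets (\<nu> u) = sigma_sets (arrows X) {U. openin (gtop X) U}"
    "\<And>K. compactin (gtop X) K \<Longrightarrow> emeasure (\<nu> u) K < \<infinity>"
    "emeasure (\<nu> u) {x \<in> arrows X. rng X x \<noteq> u} = 0"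
    "\<And>U x. \<lbrakk>openin (gtop X) U; x \<in> U; rng X x = u\<rbrakk> \<Longrightarrow> 0 < emeasure (\<nu> u) U"
    if "u \<in> units X" for u
    using \<nu> that unfolding left_haar_system_def by blast+
  have meas: "V \<in> sets (\<nu> u)" if "u \<in> units X" "openin (gtop X) V" for u V
    unfolding haar(2) [OF that(1)] using that(2) by (simp add: sigma_sets.Basic)
  show "openin (subtopology (gtop X) (units X)) (rng X ` U)"
  proof (subst openin_subopen, intro ballI)
    fix u assume "u \<in> rng X ` U"
    then obtain x where x: "x \<in> U" "u = rng X x" by auto
    then have u: "u \<in> units X" using sub units by auto
    obtain f :: "'a \<Rightarrow> real" where f: "continuous_map (gtop X) euclideanreal f" "\<And>y. 0 \<le> f y" "\<And>y. f y \<le> 1" "f x = 1"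
      and cc: "cc_function (gtop X) (\<lambda>y. complex_of_real (f y))"
      and supp: "\<And>y. y \<in> arrows X - U \<Longrightarrow> f y = 0"
      using locally_compact_bump [OF X U x(1)] by blast
    let ?I = "\<lambda>u. integral\<^sup>L (\<nu> u) (\<lambda>y. complex_of_real (f y))"
    let ?N = "{v \<in> topspace (subtopology (gtop X) (units X)). ?I v \<in> - {0}}"
    have "continuous_map (subtopology (gtop X) (units X)) euclidean ?I"
      using \<nu> cc unfolding left_haar_system_def by blast
    then have N: "openin (subtopology (gtop X) (units X)) ?N"
      by (rule openin_continuous_map_preimage) auto
    have pre: "openin (gtop X) {y \<in> arrows X. f y \<in> S}" if "open S" for S
      using openin_continuous_map_preimage [OF f(1)] that by simp
    have bor: "f \<in> borel_measurable (\<nu> u)"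
    proof (rule borel_measurableI)
      fix S :: "real set" assume "open S"
      then show "f -` S \<inter> space (\<nu> u) \<in> sets (\<nu> u)"
        using meas [OF u pre] by (simp add: haar(1) [OF u] vimage_def Int_def conj_commute)
    qed
    have "integrable (\<nu> u) f"
    proof -
      obtain K where K: "compactin (gtop X) K" "\<And>y. y \<in> arrows X - K \<Longrightarrow> f y = 0"
        using cc by (auto simp: cc_function_def)
      have "closedin (gtop X) K"
        using K(1) X compactin_imp_closedin by (auto simp: lchs_space_def)
      then have "openin (gtop X) (arrows X - K)" by auto
      then have "space (\<nu> u) - (arrows X - K) \<in> sets (\<nu> u)"
        using meas [OF u] by (intro sets.compl_sets) auto
      moreover have "space (\<nu> u) - (arrows X - K) = K"
        using compactin_subset_topspace [OF K(1)] by (auto simp: haar(1) [OF u])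
      ultimately have "integrable (\<nu> u) (indicat_real K)"
        using haar(3) [OF u K(1)] by (simp add: integrable_indicator_iff)
      then show ?thesis
        by (rule Bochner_Integration.integrable_bound [OF _ bor])
          (use f K(2) in \<open>auto simp: indicator_def haar(1) [OF u]\<close>)
    qed
    moreover have "emeasure (\<nu> u) {y \<in> arrows X. f y \<noteq> 0} > 0"
      using haar(5) [OF u, of "{y \<in> arrows X. f y \<noteq> 0}" x] x sub f(4) pre [of "- {0}"] by auto
    then have "\<not> (AE y in \<nu> u. f y = 0)"
      using meas [OF u pre [of "- {0}"]] by (subst AE_iff_measurable [OF _ refl]) (auto simp: haar(1) [OF u])
    ultimately have "integral\<^sup>L (\<nu> u) f \<noteq> 0"
      using integral_nonneg_eq_0_iff_AE [of "\<nu> u" f] f(2) by auto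
    then have "u \<in> ?N"
      using u by (auto simp: units_def)
    moreover have "?N \<subseteq> rng X ` U"
    proof
      fix v assume "v \<in> ?N"
      then have v: "v \<in> units X" "integral\<^sup>L (\<nu> v) f \<noteq> 0" by auto
      show "v \<in> rng X ` U"
      proof (rule ccontr)
        assume "v \<notin> rng X ` U"
        then have "{y \<in> arrows X. f y \<in> - {0}} \<subseteq> {y \<in> arrows X. rng X y \<noteq> v}"
          using supp by auto
        moreover have R: "openin (gtop X) {y \<in> arrows X. rng X y \<noteq> v}"
        proof -
          have "closedin (gtop X) {v}"
            using X v(1) by (intro closedin_Hausdorff_sing_eq [THEN iffD2]) (auto simp: lchs_space_def units_def)
          then have "openin (gtop X) {y \<in> arrows X. rng X y \<in> arrows X - {v}}"
            by (intro openin_continuous_map_preimage [OF rng]) auto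
          moreover have "{y \<in> arrows X. rng X y \<in> arrows X - {v}} = {y \<in> arrows X. rng X y \<noteq> v}"
            using continuous_map_funspace [OF rng] by auto
          ultimately show ?thesis by simp
        qed
        ultimately have "\<not> 0 < emeasure (\<nu> v) {y \<in> arrows X. f y \<in> - {0}}"
          using emeasure_mono [OF _ meas [OF v(1) R]] haar(4) [OF v(1)] by fastforce
        then have "AE y in \<nu> v. f y = 0"
          using meas [OF v(1) pre [of "- {0}"]]
          by (subst AE_iff_measurable [OF _ refl]) (auto simp: haar(1) [OF v(1)])
        then have "integral\<^sup>L (\<nu> v) f = 0"
          by (rule integral_eq_zero_AE)
        then show False using v(2) by simp
      qed
    qed
    ultimately show "\<exists>N. openin (subtopology (gtop X) (units X)) N \<and> u \<in> N \<and> N \<subseteq> rng X ` U"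
      using N by blast
  qed
qed

section \<open>The norm of a product in a Fell bundle\<close>

locale groupoid_laws =
  fixes X :: "('x, 'k) groupoid_scheme"
  assumes algebraic_groupoid: "algebraic_groupoid X"
begin

lemma rng_closed: "x \<in> arrows X \<Longrightarrow> rng X x \<in> arrows X"
  and src_closed: "x \<in> arrows X \<Longrightarrow> src X x \<in> arrows X"
  and inv_closed: "x \<in> arrows X \<Longrightarrow> ginv X x \<in> arrows X"
  and mult_closed: "\<lbrakk>x \<in> arrows X; y \<in> arrows X; src X x = rng X y\<rbrakk> \<Longrightarrow> gmul X x y \<in> arrows X"
  and rng_rng: "x \<in> arrows X \<Longrightarrow> rng X (rng X x) = rng X x"
  and src_rng: "x \<in> arrows X \<Longrightarrow> src X (rng X x) = rng X x"
  and rng_src: "x \<in> arrows X \<Longrightarrow> rng X (src X x) = src X x"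
  and src_src: "x \<in> arrows X \<Longrightarrow> src X (src X x) = src X x"
  and rng_inv: "x \<in> arrows X \<Longrightarrow> rng X (ginv X x) = src X x"
  and src_inv: "x \<in> arrows X \<Longrightarrow> src X (ginv X x) = rng X x"
  and rng_mult: "\<lbrakk>x \<in> arrows X; y \<in> arrows X; src X x = rng X y\<rbrakk> \<Longrightarrow> rng X (gmul X x y) = rng X x"
  and src_mult: "\<lbrakk>x \<in> arrows X; y \<in> arrows X; src X x = rng X y\<rbrakk> \<Longrightarrow> src X (gmul X x y) = src X y"
  and mult_assoc: "\<lbrakk>x \<in> arrows X; y \<in> arrows X; z \<in> arrows X; src X x = rng X y; src X y = rng X z\<rbrakk>
    \<Longrightarrow> gmul X (gmul X x y) z = gmul X x (gmul X y z)"
  and rng_mult_id: "x \<in> arrows X \<Longrightarrow> gmul X (rng X x) x = x"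
  and mult_src_id: "x \<in> arrows X \<Longrightarrow> gmul X x (src X x) = x"
  and mult_inv: "x \<in> arrows X \<Longrightarrow> gmul X x (ginv X x) = rng X x"
  and inv_mult: "x \<in> arrows X \<Longrightarrow> gmul X (ginv X x) x = src X x"
  using algebraic_groupoid unfolding algebraic_groupoid_def by blast+

lemma rng_in_units: "x \<in> arrows X \<Longrightarrow> rng X x \<in> units X"
  by (simp add: units_def rng_closed rng_rng)

lemmas groupoid_simps = rng_closed src_closed inv_closed mult_closed rng_rng src_rng rng_src src_src
  rng_inv src_inv rng_mult src_mult mult_assoc rng_mult_id mult_src_id mult_inv inv_mult

end

locale fell_bundle_over = groupoid_laws X for X :: "('x, 'k) groupoid_scheme" +
  fixes A :: "('a, 'x, 'm) fell_scheme"
  assumes fell_bundle: "fell_bundle X A"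
begin

lemma banach_bundle: "banach_bundle (gtop X) A"
  using fell_bundle by (simp add: fell_bundle_def)

lemma proj_continuous: "continuous_map (btop A) (gtop X) (proj A)"
  using banach_bundle by (simp add: banach_bundle_def)

lemma proj_closed: "a \<in> tot_space A \<Longrightarrow> proj A a \<in> arrows X"
  using proj_continuous by (auto simp: continuous_map_def)

lemma fmul_bilinear: "\<lbrakk>x \<in> arrows X; y \<in> arrows X; src X x = rng X y\<rbrakk> \<Longrightarrow>
    bilinear_between (fibre A x) (fibre A y) (fibre A (gmul X x y)) (fmul A)"
  using fell_bundle by (simp add: fell_bundle_def)

lemma fmul_continuous: "continuous_map
       (subtopology (prod_topology (btop A) (btop A)) {(a, b). src X (proj A a) = rng X (proj A b)})
       (btop A) (\<lambda>(a, b). fmul A a b)"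
  using fell_bundle by (simp add: fell_bundle_def)

lemma
  assumes "a \<in> tot_space A" "b \<in> tot_space A" "src X (proj A a) = rng X (proj A b)"
  shows fmul_closed: "fmul A a b \<in> tot_space A"
    and proj_fmul: "proj A (fmul A a b) = gmul X (proj A a) (proj A b)"
  using fmul_bilinear [of "proj A a" "proj A b"] assms
  by (auto simp: proj_closed bilinear_between_def linear_between_def fibre_def)

lemma fmul_assoc:
  "\<lbrakk>a \<in> tot_space A; b \<in> tot_space A; c \<in> tot_space A;
    src X (proj A a) = rng X (proj A b); src X (proj A b) = rng X (proj A c)\<rbrakk> \<Longrightarrow>
    fmul A (fmul A a b) c = fmul A a (fmul A b c)"
  using fell_bundle by (simp add: fell_bundle_def)

lemma fadj_closed: "a \<in> tot_space A \<Longrightarrow> fadj A a \<in> tot_space A"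
  and proj_fadj: "a \<in> tot_space A \<Longrightarrow> proj A (fadj A a) = ginv X (proj A a)"
  and fadj_fadj: "a \<in> tot_space A \<Longrightarrow> fadj A (fadj A a) = a"
  and fadj_fmul: "\<lbrakk>a \<in> tot_space A; b \<in> tot_space A; src X (proj A a) = rng X (proj A b)\<rbrakk> \<Longrightarrow>
    fadj A (fmul A a b) = fmul A (fadj A b) (fadj A a)"
  using fell_bundle by (auto simp: fell_bundle_def conj_linear_between_def fibre_def proj_closed)

lemma fibre_banach: "x \<in> arrows X \<Longrightarrow> complex_banach_space (fibre A x)"
  using banach_bundle by (simp add: banach_bundle_def)

lemma norm_nonneg: "a \<in> tot_space A \<Longrightarrow> 0 \<le> bnorm A a"
  and norm_eq_0_iff: "a \<in> tot_space A \<Longrightarrow> bnorm A a = 0 \<longleftrightarrow> a = bzero A (proj A a)"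
  and norm_bscl: "a \<in> tot_space A \<Longrightarrow> bnorm A (bscl A c a) = cmod c * bnorm A a"
  and bscl_closed: "a \<in> tot_space A \<Longrightarrow> bscl A c a \<in> tot_space A"
  and proj_bscl: "a \<in> tot_space A \<Longrightarrow> proj A (bscl A c a) = proj A a"
  using fibre_banach [OF proj_closed, of a]
  by (simp_all add: complex_banach_space_def complex_vector_space_def fibre_def)

lemma bzero_closed: "x \<in> arrows X \<Longrightarrow> bzero A x \<in> tot_space A"
  and proj_bzero: "x \<in> arrows X \<Longrightarrow> proj A (bzero A x) = x"
  using fibre_banach [of x] comm_group.axioms(2) [THEN group.is_monoid, THEN monoid.one_closed]
  by (fastforce simp: complex_banach_space_def complex_vector_space_def fibre_def)+

lemma badd_closed: "\<lbrakk>a \<in> tot_space A; b \<in> tot_space A; proj A a = proj A b\<rbrakk> \<Longrightarrow> badd A a b \<in> tot_space A"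
  and proj_badd: "\<lbrakk>a \<in> tot_space A; b \<in> tot_space A; proj A a = proj A b\<rbrakk> \<Longrightarrow> proj A (badd A a b) = proj A b"
  using fibre_banach [OF proj_closed, of b] comm_group.axioms(2) [THEN group.is_monoid, THEN monoid.m_closed]
  by (fastforce simp: complex_banach_space_def complex_vector_space_def fibre_def)+

lemma imprimitivity: "x \<in> arrows X \<Longrightarrow>
    imprimitivity_bimodule (fibre_algebra A (rng X x)) (fibre_algebra A (src X x)) (fibre A x)
      (fmul A) (fmul A) (\<lambda>a b. fmul A a (fadj A b)) (\<lambda>a b. fmul A (fadj A a) b)"
  using fell_bundle by (simp add: fell_bundle_def)

lemma
  assumes "a \<in> tot_space A"
  shows norm_right_ip: "bnorm A (fmul A (fadj A a) a) = (bnorm A a)\<^sup>2"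
    and norm_left_ip: "bnorm A (fmul A a (fadj A a)) = (bnorm A a)\<^sup>2"
proof -
  have a: "a \<in> npts (fibre A (proj A a))" and [simp]: "nnorm (fibre A x) = bnorm A"
    "nnorm (fibre_algebra A x) = bnorm A" for x
    using assms by (auto simp: fibre_def fibre_algebra_def)
  have "bnorm A a = sqrt (bnorm A (fmul A (fadj A a) a))" "bnorm A a = sqrt (bnorm A (fmul A a (fadj A a)))"
    using imprimitivity [OF proj_closed [OF assms]] a
    unfolding imprimitivity_bimodule_def full_right_hilbert_module_def full_left_hilbert_module_def
    by auto
  moreover have "0 \<le> bnorm A (fmul A (fadj A a) a)" "0 \<le> bnorm A (fmul A a (fadj A a))"
    using assms by (auto intro!: norm_nonneg fmul_closed simp: fadj_closed proj_fadj groupoid_simps proj_closed)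
  ultimately show "bnorm A (fmul A (fadj A a) a) = (bnorm A a)\<^sup>2" "bnorm A (fmul A a (fadj A a)) = (bnorm A a)\<^sup>2"
    by (metis real_sqrt_pow2)+
qed

lemma norm_fmul_unit_fibre:
  assumes "a \<in> tot_space A" "b \<in> tot_space A" "proj A a = u" "proj A b = u" "u \<in> units X"
  shows "bnorm A (fmul A a b) \<le> bnorm A a * bnorm A b"
proof -
  have "cstar_algebra (fibre_algebra A u)"
    using fell_bundle assms(5) by (simp add: fell_bundle_def)
  then show ?thesis
    using assms(1-4) by (simp add: cstar_algebra_def fibre_algebra_def)
qed

lemmas bundle_simps = proj_closed fmul_closed proj_fmul fadj_closed proj_fadj fadj_fadj fadj_fmul groupoid_simps

text \<open>
  On a fibre the norm topology is finer than the one induced from the total space, so a product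
  that is continuous on the total space is norm continuous, hence bounded, in each variable.
\<close>

lemma conjugation_bounded:
  assumes b: "b \<in> tot_space A"
  obtains K where "K > 0"
    "\<And>e. \<lbrakk>e \<in> tot_space A; proj A e = rng X (proj A b)\<rbrakk> \<Longrightarrow>
      bnorm A (fmul A (fadj A b) (fmul A e b)) \<le> K * bnorm A e"
proof -
  define u where "u = rng X (proj A b)"
  define \<phi> where "\<phi> e = fmul A (fadj A b) (fmul A e b)" for e
  have u: "u \<in> arrows X" "src X u = u" "rng X u = u"
    using b by (simp_all add: u_def bundle_simps)
  have \<phi>_closed: "\<phi> e \<in> tot_space A" if "e \<in> tot_space A" "proj A e = u" for e
    using that b by (simp add: \<phi>_def bundle_simps u_def)
  have \<phi>_scl: "\<phi> (bscl A c e) = bscl A c (\<phi> e)" if e: "e \<in> tot_space A" "proj A e = u" for c e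
  proof -
    have "fmul A (bscl A c e) b = bscl A c (fmul A e b)"
      using fmul_bilinear [of u "proj A b"] e b u
      by (auto simp: bilinear_between_def linear_between_def fibre_def bundle_simps u_def)
    moreover have "fmul A (fadj A b) (bscl A c (fmul A e b)) = bscl A c (\<phi> e)"
      using fmul_bilinear [of "ginv X (proj A b)" "proj A b"] e b u
      by (auto simp: bilinear_between_def linear_between_def fibre_def bundle_simps u_def \<phi>_def)
    ultimately show ?thesis by (simp add: \<phi>_def)
  qed
  have zero: "bnorm A (bzero A u) = 0" "bscl A 0 (bzero A u) = bzero A u"
    using norm_eq_0_iff [of "bzero A u"] norm_eq_0_iff [of "bscl A 0 (bzero A u)"] norm_bscl [of "bzero A u" 0]
    by (simp_all add: bzero_closed proj_bzero u bscl_closed proj_bscl)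
  have \<phi>_zero: "bnorm A (\<phi> (bzero A u)) = 0"
    using \<phi>_scl [of "bzero A u" 0] norm_bscl [of "\<phi> (bzero A u)" 0] zero
    by (simp add: bzero_closed proj_bzero u \<phi>_closed)
  let ?F = "subtopology (btop A) {e. proj A e = u}"
  have "continuous_map ?F (btop A) (\<lambda>e. fmul A e b)"
    using b u by (intro continuous_map_compose_pair [OF _ _ fmul_continuous])
      (auto simp: continuous_map_from_subtopology u_def)
  then have "continuous_map ?F (btop A) \<phi>"
    unfolding \<phi>_def using b u by (intro continuous_map_compose_pair [OF _ _ fmul_continuous])
      (auto simp: bundle_simps u_def)
  moreover have "openin (btop A) {a \<in> tot_space A. bnorm A a < 1}"
    using banach_bundle by (simp add: banach_bundle_def)
  ultimately have "openin ?F {e \<in> topspace ?F. \<phi> e \<in> {a \<in> tot_space A. bnorm A a < 1}}"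
    by (rule openin_continuous_map_preimage)
  then obtain V where V: "openin (btop A) V"
    "{e \<in> topspace ?F. \<phi> e \<in> {a \<in> tot_space A. bnorm A a < 1}} = V \<inter> {e. proj A e = u}"
    by (auto simp: openin_subtopology)
  have "bzero A u \<in> V \<inter> {e. proj A e = u}"
    unfolding V(2) [symmetric] using \<phi>_zero by (simp add: bzero_closed proj_bzero u \<phi>_closed)
  then have zV: "bzero A u \<in> V" by simp
  \<comment> \<open>Otherwise some \<open>e n\<close> tend to zero in norm, hence in the total space, without entering \<open>V\<close>.\<close>
  have "\<exists>\<delta>>0. \<forall>e. e \<in> tot_space A \<and> proj A e = u \<and> bnorm A e < \<delta> \<longrightarrow> bnorm A (\<phi> e) < 1"
  proof (rule ccontr)
    assume "\<not> ?thesis"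
    then have "\<exists>e. e \<in> tot_space A \<and> proj A e = u \<and> bnorm A e < inverse (real (Suc n)) \<and> \<not> bnorm A (\<phi> e) < 1" for n
      by (metis inverse_positive_iff_positive of_nat_0_less_iff zero_less_Suc)
    then obtain e where e: "\<And>n. e n \<in> tot_space A" "\<And>n. proj A (e n) = u"
      "\<And>n. bnorm A (e n) < inverse (real (Suc n))" "\<And>n. \<not> bnorm A (\<phi> (e n)) < 1"
      by metis
    let ?G = "filtermap e sequentially"
    have "bnorm A (e n) \<le> inverse (real (Suc n))" for n
      using e(3) by (rule less_imp_le)
    then have "(\<lambda>n. bnorm A (e n)) \<longlonglongrightarrow> 0"
      by (intro tendsto_sandwich [OF _ _ tendsto_const LIMSEQ_inverse_real_of_nat]
          always_eventually allI norm_nonneg e(1))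
    then have "(bnorm A \<longlongrightarrow> 0) ?G"
      by (simp add: filterlim_filtermap)
    moreover have "eventually (\<lambda>a. a \<in> tot_space A) ?G" "limitin (gtop X) (proj A) u ?G"
      using e u by (simp_all add: eventually_filtermap limitin_def)
    ultimately have "limitin (btop A) (\<lambda>a. a) (bzero A u) ?G"
      using banach_bundle by (simp add: banach_bundle_def)
    then have "\<forall>\<^sub>F n in sequentially. e n \<in> V"
      using V(1) zV by (simp add: limitin_def eventually_filtermap)
    then obtain n where "e n \<in> V"
      using eventually_happens' by fastforce
    then have "e n \<in> V \<inter> {e. proj A e = u}" using e by simp
    then show False
      unfolding V(2) [symmetric] using e(4) by simp
  qed
  then obtain \<delta> where \<delta>: "\<delta> > 0" "\<And>e. \<lbrakk>e \<in> tot_space A; proj A e = u; bnorm A e < \<delta>\<rbrakk> \<Longrightarrow> bnorm A (\<phi> e) < 1"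
    by blast
  have "bnorm A (\<phi> e) \<le> 2 / \<delta> * bnorm A e" if e: "e \<in> tot_space A" "proj A e = u" for e
  proof (cases "bnorm A e = 0")
    case True
    then have "e = bzero A u" using norm_eq_0_iff [OF e(1)] e(2) by simp
    then show ?thesis using \<phi>_zero True by simp
  next
    case False
    then have pos: "bnorm A e > 0" using norm_nonneg [OF e(1)] by simp
    \<comment> \<open>scales \<open>e\<close> to norm \<open>\<delta> / 2\<close>\<close>
    define c where "c = complex_of_real (\<delta> / (2 * bnorm A e))"
    have c: "cmod c = \<delta> / (2 * bnorm A e)"
      using \<delta>(1) pos unfolding c_def norm_of_real by simp
    have "bnorm A (bscl A c e) < \<delta>"
      using \<delta>(1) pos by (simp add: norm_bscl e c)
    then have "cmod c * bnorm A (\<phi> e) < 1"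
      using \<delta>(2) [of "bscl A c e"] \<phi>_scl [OF e] e by (simp add: bscl_closed proj_bscl norm_bscl \<phi>_closed)
    then show ?thesis
      using \<delta>(1) pos by (simp add: c field_simps)
  qed
  then show ?thesis
    using \<delta>(1) by (intro that [of "2 / \<delta>"]) (auto simp: u_def \<phi>_def)
qed

text \<open>
  Put \<open>c = a* a\<close>, \<open>d = b b*\<close> and \<open>\<phi> f = b* f b\<close>, so that \<open>\<parallel>a b\<parallel>\<close> squared is \<open>\<parallel>\<phi> c\<parallel>\<close>. Squaring \<open>\<phi> f\<close> gives
  \<open>\<phi> (f d f)\<close>; iterating \<open>k\<close> times from \<open>f = c\<close>, the C*-identity turns the norm of the result into the
  \<open>2 ^ k\<close>-th power of \<open>\<parallel>\<phi> c\<parallel>\<close>, while boundedness of \<open>\<phi>\<close> and the submultiplicative norm of the unit fibre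
  bound it by a constant times the \<open>2 ^ k\<close>-th power of \<open>\<parallel>c\<parallel> \<parallel>d\<parallel>\<close>. The constant disappears in the limit of
  \<open>2 ^ k\<close>-th roots.
\<close>

theorem norm_fmul:
  assumes a: "a \<in> tot_space A" and b: "b \<in> tot_space A" and ab: "src X (proj A a) = rng X (proj A b)"
  shows "bnorm A (fmul A a b) \<le> bnorm A a * bnorm A b"
proof -
  define u where "u = rng X (proj A b)"
  define d where "d = fmul A b (fadj A b)"
  define e where "e = rec_nat (fmul A (fadj A a) a) (\<lambda>_ f. fmul A (fmul A f d) f)"
  define \<phi> where "\<phi> f = fmul A (fadj A b) (fmul A f b)" for f
  have e0: "e 0 = fmul A (fadj A a) a" and e_Suc: "e (Suc k) = fmul A (fmul A (e k) d) (e k)" for k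
    by (simp_all add: e_def)
  have u: "u \<in> units X" "u \<in> arrows X" "src X u = u" "rng X u = u" "gmul X u u = u"
    using b rng_mult_id [of u] by (auto simp: u_def bundle_simps rng_in_units)
  have d: "d \<in> tot_space A" "proj A d = u" "fadj A d = d" "bnorm A d = (bnorm A b)\<^sup>2"
    using b by (simp_all add: d_def bundle_simps norm_left_ip u_def)
  have e: "e k \<in> tot_space A \<and> proj A (e k) = u \<and> fadj A (e k) = e k" for k
  proof (induction k)
    case 0
    then show ?case using a ab by (simp add: e0 bundle_simps u_def)
  next
    case (Suc k)
    then show ?case using d u by (simp add: e_Suc bundle_simps fmul_assoc)
  qed
  have \<phi>_closed: "\<phi> (e k) \<in> tot_space A" "proj A (\<phi> (e k)) = src X (proj A b)" "fadj A (\<phi> (e k)) = \<phi> (e k)" for k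
    using e [of k] b by (simp_all add: \<phi>_def bundle_simps u_def fmul_assoc)
  have \<phi>_Suc: "\<phi> (e (Suc k)) = fmul A (\<phi> (e k)) (\<phi> (e k))" for k
    using e [of k] b by (simp add: \<phi>_def e_Suc d_def bundle_simps u_def fmul_assoc)
  have \<phi>_norm: "bnorm A (\<phi> (e k)) = bnorm A (\<phi> (e 0)) ^ (2 ^ k)" for k
  proof (induction k)
    case (Suc k)
    have "bnorm A (\<phi> (e (Suc k))) = (bnorm A (\<phi> (e k)))\<^sup>2"
      using norm_right_ip [OF \<phi>_closed(1) [of k]] by (simp add: \<phi>_closed \<phi>_Suc)
    then show ?case
      by (simp add: Suc power_mult [symmetric] mult.commute)
  qed simp
  define M where "M = (bnorm A a)\<^sup>2 * (bnorm A b)\<^sup>2"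
  have e_norm: "bnorm A (e k) * bnorm A d \<le> M ^ (2 ^ k)" for k
  proof (induction k)
    case 0
    then show ?case using a by (simp add: e0 norm_right_ip d M_def)
  next
    case (Suc k)
    have ek: "e k \<in> tot_space A" "proj A (e k) = u" using e by auto
    have "bnorm A (e (Suc k)) \<le> bnorm A (fmul A (e k) d) * bnorm A (e k)"
      unfolding e_Suc using ek d u
      by (intro norm_fmul_unit_fibre [where u = u]) (simp_all add: bundle_simps)
    also have "\<dots> \<le> bnorm A (e k) * bnorm A d * bnorm A (e k)"
      using ek d u by (intro mult_right_mono norm_nonneg norm_fmul_unit_fibre [where u = u])
    finally have "bnorm A (e (Suc k)) * bnorm A d \<le> bnorm A (e k) * bnorm A d * bnorm A (e k) * bnorm A d"
      by (rule mult_right_mono) (rule norm_nonneg [OF d(1)])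
    also have "\<dots> = (bnorm A (e k) * bnorm A d)\<^sup>2"
      by (simp add: power2_eq_square mult_ac)
    also have "\<dots> \<le> (M ^ 2 ^ k)\<^sup>2"
      using Suc ek d by (intro power_mono) (auto simp: norm_nonneg)
    finally show ?case
      by (simp add: power_mult [symmetric] mult.commute)
  qed
  obtain K where K: "K > 0" "\<And>e. \<lbrakk>e \<in> tot_space A; proj A e = u\<rbrakk> \<Longrightarrow> bnorm A (\<phi> e) \<le> K * bnorm A e"
    using conjugation_bounded [OF b] unfolding u_def \<phi>_def by blast
  define r where "r = (bnorm A (fmul A a b))\<^sup>2"
  have r: "r = bnorm A (\<phi> (e 0))"
    using norm_right_ip [of "fmul A a b"] a b ab
    by (simp add: r_def \<phi>_def e0 bundle_simps fmul_assoc)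
  have bound: "bnorm A d * r ^ (2 ^ k) \<le> K * M ^ (2 ^ k)" for k
  proof -
    have "bnorm A d * r ^ (2 ^ k) = bnorm A d * bnorm A (\<phi> (e k))"
      by (simp only: \<phi>_norm [of k] r)
    also have "\<dots> \<le> bnorm A d * (K * bnorm A (e k))"
      using e [of k] d by (intro mult_left_mono K norm_nonneg) auto
    also have "\<dots> = K * (bnorm A (e k) * bnorm A d)" by simp
    also have "\<dots> \<le> K * M ^ (2 ^ k)"
      using K(1) e_norm by (intro mult_left_mono) auto
    finally show ?thesis .
  qed
  have "r \<le> M"
  proof (cases "bnorm A d = 0")
    case True
    then have "bnorm A b = 0" using d by simp
    then have "b = bzero A (proj A b)" using norm_eq_0_iff b by blast
    have "bscl A 0 b = b"
      using norm_eq_0_iff [of "bscl A 0 b"] \<open>b = bzero A (proj A b)\<close> b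
      by (simp add: bscl_closed proj_bscl norm_bscl)
    moreover have "fmul A a (bscl A 0 b) = bscl A 0 (fmul A a b)"
      using fmul_bilinear [of "proj A a" "proj A b"] a b ab
      by (simp add: bilinear_between_def linear_between_def fibre_def proj_closed)
    ultimately have "bnorm A (fmul A a b) = 0"
      using norm_bscl [of "fmul A a b" 0] a b ab by (simp add: fmul_closed)
    then show ?thesis by (simp add: r_def M_def)
  next
    case False
    then have d_pos: "bnorm A d > 0" using norm_nonneg [OF d(1)] by simp
    show ?thesis
    proof (rule ccontr)
      assume "\<not> r \<le> M"
      then have less: "M < r" by simp
      show False
      proof (cases "M = 0")
        case True
        then show ?thesis using bound [of 0] d_pos less by (simp add: mult_le_0_iff)
      next
        case False
        then have M: "M > 0" by (simp add: M_def)
        then have "1 < r / M" using less by simp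
        then obtain n where n: "K / bnorm A d < (r / M) ^ n"
          using real_arch_pow by blast
        also have "\<dots> \<le> (r / M) ^ (2 ^ n)"
          using \<open>1 < r / M\<close> by (intro power_increasing) auto
        finally show False
          using bound [of n] M d_pos by (simp add: power_divide field_simps)
      qed
    qed
  qed
  then show ?thesis
    unfolding r_def M_def power_mult_distrib [symmetric]
    using a b by (auto intro!: power2_le_imp_le mult_nonneg_nonneg norm_nonneg)
qed

end

section \<open>The operations of the orbit bundle on representatives\<close>

lemma homeomorphic_map_idempotent:
  assumes "homeomorphic_map T T f" "x \<in> topspace T" "f (f x) = f x"
  shows "f x = x"
proof -
  have "f x \<in> topspace T" "inj_on f (topspace T)"
    using assms(1,2) by (auto simp: homeomorphic_eq_everything_map)
  then show ?thesis
    using assms(2,3) by (auto dest: inj_onD)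
qed

context free_proper_right_action
begin

text \<open>
  The matching condition on the representatives forces them to be translates of \<open>a\<close> and \<open>b\<close> by
  the same group element, because the action is free on \<open>T\<close>.
\<close>

lemma the_orb_pair:
  assumes "a \<in> orb H \<beta>1 a" "b \<in> orb H \<beta>2 b"
    and ab: "k1 a = k2 b" "k1 a \<in> topspace T"
    and k1: "\<And>h. h \<in> carrier H \<Longrightarrow> k1 (\<beta>1 a h) = \<beta> (k1 a) h"
    and k2: "\<And>h. h \<in> carrier H \<Longrightarrow> k2 (\<beta>2 b h) = \<beta> (k2 b) h"
    and F: "\<And>h. h \<in> carrier H \<Longrightarrow> F (\<beta>1 a h) (\<beta>2 b h) = F a b"
  shows "(THE d. \<exists>a'\<in>orb H \<beta>1 a. \<exists>b'\<in>orb H \<beta>2 b. k1 a' = k2 b' \<and> d = F a' b') = F a b"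
proof (rule the_equality)
  show "\<exists>a'\<in>orb H \<beta>1 a. \<exists>b'\<in>orb H \<beta>2 b. k1 a' = k2 b' \<and> F a b = F a' b'"
    using assms by blast
next
  fix d assume "\<exists>a'\<in>orb H \<beta>1 a. \<exists>b'\<in>orb H \<beta>2 b. k1 a' = k2 b' \<and> d = F a' b'"
  then obtain h k where hk: "h \<in> carrier H" "k \<in> carrier H" "k1 (\<beta>1 a h) = k2 (\<beta>2 b k)" "d = F (\<beta>1 a h) (\<beta>2 b k)"
    by (auto simp: orb_def)
  then have "\<beta> (k1 a) h = \<beta> (k1 a) k"
    using k1 k2 ab(1) by simp
  then have "h = k"
    using act_inj ab(2) hk(1,2) by blast
  then show "d = F a b"
    using hk F by simp
qed

end

lemma (in groupoid_laws) rng_continuous: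
  assumes "lc_groupoid X"
  shows "continuous_map (gtop X) (gtop X) (rng X)"
proof -
  have "continuous_map (gtop X) (gtop X) (ginv X)"
    "continuous_map (subtopology (prod_topology (gtop X) (gtop X)) {(x, y). src X x = rng X y}) (gtop X)
      (\<lambda>(x, y). gmul X x y)"
    using assms by (simp_all add: lc_groupoid_def)
  then have "continuous_map (gtop X) (gtop X) (\<lambda>x. gmul X x (ginv X x))"
    by (intro continuous_map_compose_pair [where F = "gmul X" and f = "\<lambda>x. x" and g = "ginv X"])
      (auto simp: groupoid_simps)
  then show ?thesis
    by (rule continuous_map_eq) (simp add: mult_inv)
qed

lemma (in groupoid_laws) src_continuous:
  assumes "lc_groupoid X"
  shows "continuous_map (gtop X) (gtop X) (src X)"
proof -
  have "continuous_map (gtop X) (gtop X) (ginv X)"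
    "continuous_map (subtopology (prod_topology (gtop X) (gtop X)) {(x, y). src X x = rng X y}) (gtop X)
      (\<lambda>(x, y). gmul X x y)"
    using assms by (simp_all add: lc_groupoid_def)
  then have "continuous_map (gtop X) (gtop X) (\<lambda>x. gmul X (ginv X x) x)"
    by (intro continuous_map_compose_pair [where F = "gmul X" and f = "ginv X" and g = "\<lambda>x. x"])
      (auto simp: groupoid_simps)
  then show ?thesis
    by (rule continuous_map_eq) (simp add: inv_mult)
qed

lemma (in groupoid_laws) groupoid_automorphismD:
  assumes "groupoid_automorphism X f"
  shows "x \<in> arrows X \<Longrightarrow> f x \<in> arrows X"
    and "x \<in> arrows X \<Longrightarrow> rng X (f x) = f (rng X x)"
    and "x \<in> arrows X \<Longrightarrow> src X (f x) = f (src X x)"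
    and "\<lbrakk>x \<in> arrows X; y \<in> arrows X; src X x = rng X y\<rbrakk> \<Longrightarrow> f (gmul X x y) = gmul X (f x) (f y)"
  using assms by (auto simp: groupoid_automorphism_def homeomorphic_eq_everything_map)

lemma (in fell_bundle_over) fell_automorphismD:
  assumes "fell_automorphism X A f \<phi>"
  shows "a \<in> tot_space A \<Longrightarrow> \<phi> a \<in> tot_space A"
    and "a \<in> tot_space A \<Longrightarrow> proj A (\<phi> a) = f (proj A a)"
    and "\<lbrakk>a \<in> tot_space A; b \<in> tot_space A; proj A a = proj A b\<rbrakk> \<Longrightarrow> \<phi> (badd A a b) = badd A (\<phi> a) (\<phi> b)"
    and "a \<in> tot_space A \<Longrightarrow> \<phi> (bscl A c a) = bscl A c (\<phi> a)"
    and "a \<in> tot_space A \<Longrightarrow> bnorm A (\<phi> a) = bnorm A a"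
    and "\<lbrakk>a \<in> tot_space A; b \<in> tot_space A; src X (proj A a) = rng X (proj A b)\<rbrakk> \<Longrightarrow>
      \<phi> (fmul A a b) = fmul A (\<phi> a) (\<phi> b)"
    and "a \<in> tot_space A \<Longrightarrow> \<phi> (fadj A a) = fadj A (\<phi> a)"
proof -
  show "a \<in> tot_space A \<Longrightarrow> \<phi> a \<in> tot_space A"
    using assms by (auto simp: fell_automorphism_def homeomorphic_eq_everything_map)
  have "linear_between (fibre A (proj A a)) (fibre A (f (proj A a))) \<phi>" if "a \<in> tot_space A"
    using assms proj_closed that by (simp add: fell_automorphism_def)
  then show "\<lbrakk>a \<in> tot_space A; b \<in> tot_space A; proj A a = proj A b\<rbrakk> \<Longrightarrow> \<phi> (badd A a b) = badd A (\<phi> a) (\<phi> b)"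
    and "a \<in> tot_space A \<Longrightarrow> \<phi> (bscl A c a) = bscl A c (\<phi> a)"
    by (simp_all add: linear_between_def fibre_def)
qed (use assms in \<open>simp_all add: fell_automorphism_def\<close>)

locale right_fell_system = fell_bundle_over X A
  for X :: "('x, 'k) groupoid_scheme" and A :: "('a, 'x, 'm) fell_scheme" +
  fixes H :: "('h, 'l) top_group_scheme" and \<beta>X \<beta>A
  assumes lc_groupoid: "lc_groupoid X"
    and lc_group: "lc_group H"
    and right_fell_action: "right_fell_action H X A \<beta>X \<beta>A"
    and free: "free_right_action H (gtop X) \<beta>X"
    and proper: "proper_right_action H (gtop X) \<beta>X"
begin

lemma group: "group H"
  using lc_group by (simp add: lc_group_def)

lemma right_groupoid_action: "right_groupoid_action H X \<beta>X"
  using right_fell_action by (simp add: right_fell_action_def)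

lemma groupoid_auto: "h \<in> carrier H \<Longrightarrow> groupoid_automorphism X (\<lambda>x. \<beta>X x h)"
  using right_groupoid_action by (simp add: right_groupoid_action_def)

lemma fell_auto: "h \<in> carrier H \<Longrightarrow> fell_automorphism X A (\<lambda>x. \<beta>X x h) (\<lambda>a. \<beta>A a h)"
  using right_fell_action by (simp add: right_fell_action_def)

sublocale base: free_proper_right_action H "gtop X" \<beta>X
proof -
  interpret group H by (rule group)
  show "free_proper_right_action H (gtop X) \<beta>X"
    using right_groupoid_action lc_group right_action_one [OF group right_groupoid_action] free proper
    by unfold_locales (auto simp: lc_group_def right_groupoid_action_def)
qed

sublocale total: right_action H "btop A" \<beta>A
proof -
  have hom: "homeomorphic_map (btop A) (btop A) (\<lambda>a. \<beta>A a \<one>\<^bsub>H\<^esub>)"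
    using fell_auto [OF base.one_closed] by (simp add: fell_automorphism_def)
  have assoc: "\<beta>A (\<beta>A a h) k = \<beta>A a (h \<otimes>\<^bsub>H\<^esub> k)"
    if "a \<in> tot_space A" "h \<in> carrier H" "k \<in> carrier H" for a h k
    using right_fell_action that by (simp add: right_fell_action_def)
  have "\<beta>A a \<one>\<^bsub>H\<^esub> = a" if "a \<in> tot_space A" for a
    using homeomorphic_map_idempotent [OF hom that] assoc [OF that] by simp
  then show "right_action H (btop A) \<beta>A"
    using right_fell_action base.group_top assoc
    by unfold_locales (simp_all add: right_fell_action_def)
qed

sublocale base_rng: equivariant_map H "gtop X" \<beta>X "gtop X" \<beta>X "rng X"
  using groupoid_automorphismD(2) [OF groupoid_auto] rng_continuous [OF lc_groupoid]
  by unfold_locales auto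

sublocale base_src: equivariant_map H "gtop X" \<beta>X "gtop X" \<beta>X "src X"
  using groupoid_automorphismD(3) [OF groupoid_auto] src_continuous [OF lc_groupoid]
  by unfold_locales auto

sublocale total_proj: equivariant_map H "btop A" \<beta>A "gtop X" \<beta>X "proj A"
  using fell_automorphismD(2) [OF fell_auto] proj_continuous
  by unfold_locales auto

sublocale total_src: equivariant_map H "btop A" \<beta>A "gtop X" \<beta>X "\<lambda>a. src X (proj A a)"
  using total_proj.sigma_act base_src.sigma_act proj_closed
    continuous_map_compose [OF proj_continuous src_continuous [OF lc_groupoid]]
  by unfold_locales (auto simp: o_def)

abbreviation XH where "XH \<equiv> orbit_groupoid H X \<beta>X"
abbreviation AH where "AH \<equiv> orbit_bundle H X A \<beta>X \<beta>A"
abbreviation orbX where "orbX \<equiv> orb H \<beta>X"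
abbreviation orbA where "orbA \<equiv> orb H \<beta>A"

lemma gtop_XH: "gtop XH = base.orbs" and btop_AH: "btop AH = total.orbs"
  by (simp_all add: orbit_groupoid_def orbit_bundle_def)

lemma rng_XH: "x \<in> arrows X \<Longrightarrow> rng XH (orbX x) = orbX (rng X x)"
  using base.the_orb [of x "\<lambda>x. orbX (rng X x)"]
  by (simp add: orbit_groupoid_def base_rng.sigma_act base.orb_act rng_closed)

lemma src_XH: "x \<in> arrows X \<Longrightarrow> src XH (orbX x) = orbX (src X x)"
  using base.the_orb [of x "\<lambda>x. orbX (src X x)"]
  by (simp add: orbit_groupoid_def base_src.sigma_act base.orb_act src_closed)

lemma gmul_XH: "\<lbrakk>x \<in> arrows X; y \<in> arrows X; src X x = rng X y\<rbrakk> \<Longrightarrow> gmul XH (orbX x) (orbX y) = orbX (gmul X x y)"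
  by (rule gmul_orbit_groupoid [OF group right_groupoid_action free algebraic_groupoid])

lemma proj_AH: "a \<in> tot_space A \<Longrightarrow> proj AH (orbA a) = orbX (proj A a)"
  using total.the_orb [of a "\<lambda>a. orbX (proj A a)"]
  by (simp add: orbit_bundle_def total_proj.sigma_act base.orb_act proj_closed)

lemma bscl_AH: "a \<in> tot_space A \<Longrightarrow> bscl AH c (orbA a) = orbA (bscl A c a)"
  using total.the_orb [of a "\<lambda>a. orbA (bscl A c a)"] fell_automorphismD(4) [OF fell_auto, symmetric]
  by (simp add: orbit_bundle_def total.orb_act bscl_closed)

lemma bnorm_AH: "a \<in> tot_space A \<Longrightarrow> bnorm AH (orbA a) = bnorm A a"
  using total.the_orb [of a "bnorm A"] fell_automorphismD(5) [OF fell_auto]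
  by (simp add: orbit_bundle_def)

lemma fadj_AH: "a \<in> tot_space A \<Longrightarrow> fadj AH (orbA a) = orbA (fadj A a)"
  using total.the_orb [of a "\<lambda>a. orbA (fadj A a)"] fell_automorphismD(7) [OF fell_auto, symmetric]
  by (simp add: orbit_bundle_def total.orb_act fadj_closed)

lemma badd_AH:
  assumes "a \<in> tot_space A" "b \<in> tot_space A" "proj A a = proj A b"
  shows "badd AH (orbA a) (orbA b) = orbA (badd A a b)"
proof -
  have "orbA (badd A (\<beta>A a h) (\<beta>A b h)) = orbA (badd A a b)" if h: "h \<in> carrier H" for h
    using fell_automorphismD(3) [OF fell_auto [OF h] assms, symmetric] h assms
    by (simp add: total.orb_act badd_closed)
  then have "(THE d. \<exists>a'\<in>orbA a. \<exists>b'\<in>orbA b. proj A a' = proj A b' \<and> d = orbA (badd A a' b')) = orbA (badd A a b)"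
    using assms by (intro base.the_orb_pair [where F = "\<lambda>a b. orbA (badd A a b)"])
      (simp_all add: total.orb_self total_proj.sigma_act proj_closed)
  then show ?thesis
    by (simp add: orbit_bundle_def)
qed

lemma fmul_AH:
  assumes "a \<in> tot_space A" "b \<in> tot_space A" "src X (proj A a) = rng X (proj A b)"
  shows "fmul AH (orbA a) (orbA b) = orbA (fmul A a b)"
proof -
  have "orbA (fmul A (\<beta>A a h) (\<beta>A b h)) = orbA (fmul A a b)" if h: "h \<in> carrier H" for h
    using fell_automorphismD(6) [OF fell_auto [OF h] assms, symmetric] h assms
    by (simp add: total.orb_act fmul_closed)
  then have "(THE d. \<exists>a'\<in>orbA a. \<exists>b'\<in>orbA b. src X (proj A a') = rng X (proj A b') \<and> d = orbA (fmul A a' b'))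
      = orbA (fmul A a b)"
    using assms by (intro base.the_orb_pair [where F = "\<lambda>a b. orbA (fmul A a b)"])
      (simp_all add: total.orb_self total_proj.sigma_act base_rng.sigma_act base_src.sigma_act proj_closed rng_closed)
  then show ?thesis
    by (simp add: orbit_bundle_def)
qed

text \<open>Orbits that are composable in the quotient have composable representatives.\<close>

lemma XH_composableE:
  assumes "c \<in> arrows XH" "y \<in> arrows X" "src XH c = orbX (rng X y)"
  obtains x where "x \<in> arrows X" "c = orbX x" "src X x = rng X y"
  by (rule base_src.orb_sigma_eqE [of c "rng X y"])
    (use assms that in \<open>auto simp: gtop_XH src_XH rng_closed\<close>)

lemma AH_composableE:
  assumes "c \<in> tot_space AH" "y \<in> arrows X" "src XH (proj AH c) = orbX (rng X y)"
  obtains a where "a \<in> tot_space A" "c = orbA a" "src X (proj A a) = rng X y"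
  by (rule total_src.orb_sigma_eqE [of c "rng X y"])
    (use assms that in \<open>auto simp: btop_AH src_XH proj_AH rng_closed proj_closed\<close>)

lemma AH_fibreE:
  assumes "c \<in> tot_space AH" "x \<in> arrows X" "proj AH c = orbX x"
  obtains a where "a \<in> tot_space A" "c = orbA a" "proj A a = x"
  by (rule total_proj.orb_sigma_eqE [of c x])
    (use assms that in \<open>auto simp: btop_AH proj_AH\<close>)

lemma arrows_XH_E:
  assumes "c \<in> arrows XH"
  obtains x where "x \<in> arrows X" "c = orbX x"
  using assms base.orbs_E by (metis gtop_XH)

lemma tot_AH_E:
  assumes "c \<in> tot_space AH"
  obtains a where "a \<in> tot_space A" "c = orbA a"
  using assms total.orbs_E by (metis btop_AH)

lemmas orbit_simps = rng_XH src_XH gmul_XH proj_AH bscl_AH bnorm_AH fadj_AH badd_AH fmul_AH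

end

section \<open>The action on orbits\<close>

locale commuting_action = right_action H T \<beta> + G: group G
  for H :: "('h, 'l) top_group_scheme" and T :: "'s topology" and \<beta>
    and G :: "('g, 'k) top_group_scheme" +
  fixes \<alpha> :: "'g \<Rightarrow> 's \<Rightarrow> 's"
  assumes left_top: "topspace (gr_top G) = carrier G"
    and left_continuous: "continuous_map (prod_topology (gr_top G) T) T (\<lambda>(s, x). \<alpha> s x)"
    and left_assoc: "\<lbrakk>s \<in> carrier G; t \<in> carrier G; x \<in> topspace T\<rbrakk> \<Longrightarrow> \<alpha> s (\<alpha> t x) = \<alpha> (s \<otimes>\<^bsub>G\<^esub> t) x"
    and left_one: "x \<in> topspace T \<Longrightarrow> \<alpha> \<one>\<^bsub>G\<^esub> x = x"
    and left_commute: "\<lbrakk>s \<in> carrier G; x \<in> topspace T; h \<in> carrier H\<rbrakk> \<Longrightarrow> \<alpha> s (\<beta> x h) = \<beta> (\<alpha> s x) h"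
begin

lemma left_closed: "\<lbrakk>s \<in> carrier G; x \<in> topspace T\<rbrakk> \<Longrightarrow> \<alpha> s x \<in> topspace T"
  using continuous_map_funspace [OF left_continuous] left_top by (auto simp: Pi_iff)

lemma left_orb: "\<lbrakk>s \<in> carrier G; x \<in> topspace T\<rbrakk> \<Longrightarrow> \<alpha> s ` orb H \<beta> x = orb H \<beta> (\<alpha> s x)"
  by (rule image_orb) (rule left_commute)

lemma left_orb_assoc:
  "\<lbrakk>s \<in> carrier G; t \<in> carrier G; c \<in> topspace orbs\<rbrakk> \<Longrightarrow> \<alpha> s ` \<alpha> t ` c = \<alpha> (s \<otimes>\<^bsub>G\<^esub> t) ` c"
  by (erule orbs_E) (simp add: left_orb left_closed left_assoc)

lemma left_orb_one: "c \<in> topspace orbs \<Longrightarrow> \<alpha> \<one>\<^bsub>G\<^esub> ` c = c"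
  by (erule orbs_E) (simp add: left_orb left_one)

lemma left_orb_continuous: "continuous_map (prod_topology (gr_top G) orbs) orbs (\<lambda>(s, c). \<alpha> s ` c)"
proof -
  have "continuous_map (prod_topology T (gr_top G)) orbs (\<lambda>z. orb H \<beta> (\<alpha> (snd z) (fst z)))"
    using continuous_map_compose [OF continuous_map_compose_pair_total
        [OF continuous_map_snd continuous_map_fst left_continuous] orb_continuous]
    by (simp add: o_def)
  then have "continuous_map (prod_topology T (gr_top G)) orbs (\<lambda>(x, s). \<alpha> s ` orb H \<beta> x)"
    by (rule continuous_map_eq) (clarsimp simp: left_orb left_top)
  then have "continuous_map (prod_topology orbs (gr_top G)) orbs (\<lambda>(c, s). \<alpha> s ` c)"
    using continuous_map_on_orbits [where D = UNIV and f = "\<lambda>c s. \<alpha> s ` c"] by simp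
  from continuous_map_compose_pair_total [OF continuous_map_snd continuous_map_fst this]
  show ?thesis
    by (simp add: case_prod_unfold)
qed

lemma left_orb_homeomorphic:
  assumes s: "s \<in> carrier G"
  shows "homeomorphic_map orbs orbs ((`) (\<alpha> s))"
proof -
  have "continuous_map orbs orbs (\<lambda>c. \<alpha> t ` c)" if "t \<in> carrier G" for t
    by (rule continuous_map_compose_pair_total [OF _ _ left_orb_continuous]) (simp_all add: that left_top)
  moreover have "\<alpha> s ` \<alpha> (inv\<^bsub>G\<^esub> s) ` c = c" "\<alpha> (inv\<^bsub>G\<^esub> s) ` \<alpha> s ` c = c" if "c \<in> topspace orbs" for c
    using s that by (simp_all only: left_orb_assoc G.inv_closed G.r_inv G.l_inv left_orb_one)
  ultimately have "homeomorphic_maps orbs orbs ((`) (\<alpha> s)) ((`) (\<alpha> (inv\<^bsub>G\<^esub> s)))"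
    using s by (simp add: homeomorphic_maps_def)
  then show ?thesis
    by (auto simp: homeomorphic_map_maps)
qed

end

locale commuting_fell_actions = right_fell_system X A H \<beta>X \<beta>A
  for X :: "('x, 'k) groupoid_scheme" and A :: "('a, 'x, 'm) fell_scheme"
    and H :: "('h, 'l) top_group_scheme" and \<beta>X \<beta>A +
  fixes G :: "('g, 'n) top_group_scheme" and \<alpha>X \<alpha>A
  assumes lc_group_G: "lc_group G"
    and left_fell_action: "left_fell_action G X A \<alpha>X \<alpha>A"
    and commute_X: "\<lbrakk>s \<in> carrier G; x \<in> arrows X; h \<in> carrier H\<rbrakk> \<Longrightarrow> \<alpha>X s (\<beta>X x h) = \<beta>X (\<alpha>X s x) h"
    and commute_A: "\<lbrakk>s \<in> carrier G; a \<in> tot_space A; h \<in> carrier H\<rbrakk> \<Longrightarrow> \<alpha>A s (\<beta>A a h) = \<beta>A (\<alpha>A s a) h"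
begin

lemma left_auto: "s \<in> carrier G \<Longrightarrow> fell_automorphism X A (\<alpha>X s) (\<alpha>A s)"
  using left_fell_action by (simp add: left_fell_action_def)

lemma left_groupoid_auto: "s \<in> carrier G \<Longrightarrow> groupoid_automorphism X (\<alpha>X s)"
  using left_auto by (simp add: fell_automorphism_def)

sublocale GX: commuting_action H "gtop X" \<beta>X G \<alpha>X
proof -
  interpret G: group G
    using lc_group_G by (simp add: lc_group_def)
  have assoc: "\<alpha>X s (\<alpha>X t x) = \<alpha>X (s \<otimes>\<^bsub>G\<^esub> t) x"
    if "s \<in> carrier G" "t \<in> carrier G" "x \<in> arrows X" for s t x
    using left_fell_action that by (simp add: left_fell_action_def left_groupoid_action_def)
  have hom: "homeomorphic_map (gtop X) (gtop X) (\<alpha>X \<one>\<^bsub>G\<^esub>)"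
    using left_groupoid_auto [OF G.one_closed] by (simp add: groupoid_automorphism_def)
  have "\<alpha>X \<one>\<^bsub>G\<^esub> x = x" if "x \<in> arrows X" for x
    using homeomorphic_map_idempotent [OF hom that] assoc [OF _ _ that] by simp
  then show "commuting_action H (gtop X) \<beta>X G \<alpha>X"
    using left_fell_action lc_group_G assoc commute_X
    by unfold_locales (simp_all add: left_fell_action_def left_groupoid_action_def lc_group_def)
qed

sublocale GA: commuting_action H "btop A" \<beta>A G \<alpha>A
proof -
  have assoc: "\<alpha>A s (\<alpha>A t a) = \<alpha>A (s \<otimes>\<^bsub>G\<^esub> t) a"
    if "s \<in> carrier G" "t \<in> carrier G" "a \<in> tot_space A" for s t a
    using left_fell_action that by (simp add: left_fell_action_def)
  have hom: "homeomorphic_map (btop A) (btop A) (\<alpha>A \<one>\<^bsub>G\<^esub>)"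
    using left_auto [OF GX.G.one_closed] by (simp add: fell_automorphism_def)
  have "\<alpha>A \<one>\<^bsub>G\<^esub> a = a" if "a \<in> tot_space A" for a
    using homeomorphic_map_idempotent [OF hom that] assoc [OF _ _ that] by simp
  then show "commuting_action H (btop A) \<beta>A G \<alpha>A"
    using left_fell_action GX.left_top assoc commute_A
    by unfold_locales (simp_all add: left_fell_action_def)
qed

lemma rng_left: "\<lbrakk>s \<in> carrier G; x \<in> arrows X\<rbrakk> \<Longrightarrow> rng X (\<alpha>X s x) = \<alpha>X s (rng X x)"
  and src_left: "\<lbrakk>s \<in> carrier G; x \<in> arrows X\<rbrakk> \<Longrightarrow> src X (\<alpha>X s x) = \<alpha>X s (src X x)"
  and gmul_left: "\<lbrakk>s \<in> carrier G; x \<in> arrows X; y \<in> arrows X; src X x = rng X y\<rbrakk> \<Longrightarrow>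
    \<alpha>X s (gmul X x y) = gmul X (\<alpha>X s x) (\<alpha>X s y)"
  by (simp_all add: groupoid_automorphismD [OF left_groupoid_auto])

lemma proj_left: "\<lbrakk>s \<in> carrier G; a \<in> tot_space A\<rbrakk> \<Longrightarrow> proj A (\<alpha>A s a) = \<alpha>X s (proj A a)"
  and badd_left: "\<lbrakk>s \<in> carrier G; a \<in> tot_space A; b \<in> tot_space A; proj A a = proj A b\<rbrakk> \<Longrightarrow>
    \<alpha>A s (badd A a b) = badd A (\<alpha>A s a) (\<alpha>A s b)"
  and bscl_left: "\<lbrakk>s \<in> carrier G; a \<in> tot_space A\<rbrakk> \<Longrightarrow> \<alpha>A s (bscl A c a) = bscl A c (\<alpha>A s a)"
  and bnorm_left: "\<lbrakk>s \<in> carrier G; a \<in> tot_space A\<rbrakk> \<Longrightarrow> bnorm A (\<alpha>A s a) = bnorm A a"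
  and fmul_left: "\<lbrakk>s \<in> carrier G; a \<in> tot_space A; b \<in> tot_space A; src X (proj A a) = rng X (proj A b)\<rbrakk> \<Longrightarrow>
    \<alpha>A s (fmul A a b) = fmul A (\<alpha>A s a) (\<alpha>A s b)"
  and fadj_left: "\<lbrakk>s \<in> carrier G; a \<in> tot_space A\<rbrakk> \<Longrightarrow> \<alpha>A s (fadj A a) = fadj A (\<alpha>A s a)"
  by (simp_all add: fell_automorphismD [OF left_auto])

lemmas left_simps = GX.left_closed GA.left_closed GX.left_orb GA.left_orb
  rng_left src_left gmul_left proj_left badd_left bscl_left bnorm_left fmul_left fadj_left

abbreviation \<gamma>X where "\<gamma>X s \<equiv> (`) (\<alpha>X s)"
abbreviation \<gamma>A where "\<gamma>A s \<equiv> (`) (\<alpha>A s)"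

lemma left_XH_auto:
  assumes s: "s \<in> carrier G"
  shows "groupoid_automorphism XH (\<gamma>X s)"
  unfolding groupoid_automorphism_def
proof (intro conjI ballI impI)
  show "homeomorphic_map (gtop XH) (gtop XH) (\<gamma>X s)"
    unfolding gtop_XH by (rule GX.left_orb_homeomorphic [OF s])
next
  fix c assume "c \<in> arrows XH"
  then obtain x where "x \<in> arrows X" "c = orbX x" by (rule arrows_XH_E)
  then show "rng XH (\<gamma>X s c) = \<gamma>X s (rng XH c)" "src XH (\<gamma>X s c) = \<gamma>X s (src XH c)"
    using s by (simp_all add: left_simps orbit_simps groupoid_simps)
next
  fix c d assume cd: "c \<in> arrows XH" "d \<in> arrows XH" "src XH c = rng XH d"
  then obtain y where y: "y \<in> arrows X" "d = orbX y" using arrows_XH_E by metis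
  then obtain x where "x \<in> arrows X" "c = orbX x" "src X x = rng X y"
    using XH_composableE [OF cd(1) y(1)] cd(3) by (auto simp: rng_XH)
  then show "\<gamma>X s (gmul XH c d) = gmul XH (\<gamma>X s c) (\<gamma>X s d)"
    using s y by (simp add: left_simps orbit_simps groupoid_simps)
qed

lemma left_AH_auto:
  assumes s: "s \<in> carrier G"
  shows "fell_automorphism XH AH (\<gamma>X s) (\<gamma>A s)"
  unfolding fell_automorphism_def
proof (intro conjI ballI impI)
  show "groupoid_automorphism XH (\<gamma>X s)"
    by (rule left_XH_auto [OF s])
  show "homeomorphic_map (btop AH) (btop AH) (\<gamma>A s)"
    unfolding btop_AH by (rule GA.left_orb_homeomorphic [OF s])
next
  fix c assume "c \<in> tot_space AH"
  then obtain a where "a \<in> tot_space A" "c = orbA a" by (rule tot_AH_E)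
  then show "proj AH (\<gamma>A s c) = \<gamma>X s (proj AH c)" "bnorm AH (\<gamma>A s c) = bnorm AH c"
    "\<gamma>A s (fadj AH c) = fadj AH (\<gamma>A s c)"
    using s by (simp_all add: left_simps orbit_simps bundle_simps)
next
  fix z assume "z \<in> arrows XH"
  then obtain x where x: "x \<in> arrows X" "z = orbX x" by (rule arrows_XH_E)
  have rep: "\<exists>a. a \<in> tot_space A \<and> c = orbA a \<and> proj A a = x" if "c \<in> tot_space AH" "proj AH c = z" for c
    using AH_fibreE [OF that(1) x(1)] that(2) x(2) by metis
  show "linear_between (fibre AH z) (fibre AH (\<gamma>X s z)) (\<gamma>A s)"
    unfolding linear_between_def
  proof (intro conjI ballI allI)
    fix c assume c: "c \<in> npts (fibre AH z)"
    then obtain a where a: "a \<in> tot_space A" "c = orbA a" "proj A a = x"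
      using rep [of c] by (auto simp: fibre_def)
    then show "\<gamma>A s c \<in> npts (fibre AH (\<gamma>X s z))"
      using s x total.orb_in_orbs [of "\<alpha>A s a"]
      by (simp add: fibre_def left_simps orbit_simps btop_AH)
    show "\<gamma>A s (nscl (fibre AH z) k c) = nscl (fibre AH (\<gamma>X s z)) k (\<gamma>A s c)" for k
      using s a by (simp add: fibre_def left_simps orbit_simps bscl_closed)
    fix d assume "d \<in> npts (fibre AH z)"
    then obtain b where "b \<in> tot_space A" "d = orbA b" "proj A b = x"
      using rep [of d] by (auto simp: fibre_def)
    then show "\<gamma>A s (nadd (fibre AH z) c d) = nadd (fibre AH (\<gamma>X s z)) (\<gamma>A s c) (\<gamma>A s d)"
      using s a by (simp add: fibre_def left_simps orbit_simps badd_closed)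
  qed
next
  fix c d assume cd: "c \<in> tot_space AH" "d \<in> tot_space AH" "src XH (proj AH c) = rng XH (proj AH d)"
  then obtain b where b: "b \<in> tot_space A" "d = orbA b" using tot_AH_E by metis
  then obtain a where "a \<in> tot_space A" "c = orbA a" "src X (proj A a) = rng X (proj A b)"
    using AH_composableE [OF cd(1) proj_closed [OF b(1)]] cd(3) by (auto simp: orbit_simps proj_closed)
  then show "\<gamma>A s (fmul AH c d) = fmul AH (\<gamma>A s c) (\<gamma>A s d)"
    using s b by (simp add: left_simps orbit_simps bundle_simps)
qed

theorem left_fell_action_orbit_bundle: "left_fell_action G XH AH \<gamma>X \<gamma>A"
  unfolding left_fell_action_def left_groupoid_action_def
  using left_XH_auto left_AH_auto GX.left_orb_continuous GA.left_orb_continuous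
    GX.left_orb_assoc GA.left_orb_assoc
  by (simp add: gtop_XH btop_AH)

section \<open>The action of the semidirect product\<close>

abbreviation Z where "Z \<equiv> semidirect_groupoid G XH \<gamma>X"
abbreviation C where "C \<equiv> semidirect_bundle G AH \<gamma>A"
abbreviation \<rho> where "\<rho> x \<equiv> (orbX (rng X x), \<one>\<^bsub>G\<^esub>)"

definition space_act where
  "space_act = (\<lambda>(c, t) y. gmul X (base_src.lift c (rng X (\<alpha>X t y))) (\<alpha>X t y))"

definition bundle_act where
  "bundle_act = (\<lambda>(c, t) b. fmul A (total_src.lift c (rng X (proj A (\<alpha>A t b)))) (\<alpha>A t b))"

lemma space_act_orb:
  "\<lbrakk>x \<in> arrows X; src X x = rng X (\<alpha>X t y)\<rbrakk> \<Longrightarrow> space_act (orbX x, t) y = gmul X x (\<alpha>X t y)"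
  using base_src.lift_orb [of x] by (simp add: space_act_def)

lemma bundle_act_orb:
  "\<lbrakk>a \<in> tot_space A; src X (proj A a) = rng X (proj A (\<alpha>A t b))\<rbrakk> \<Longrightarrow>
    bundle_act (orbA a, t) b = fmul A a (\<alpha>A t b)"
  using total_src.lift_orb [of a] by (simp add: bundle_act_def)

lemma Z_simps: "gtop Z = prod_topology base.orbs (gr_top G)" "rng Z (c, t) = (rng XH c, \<one>\<^bsub>G\<^esub>)"
  "src Z (c, t) = (\<gamma>X (inv\<^bsub>G\<^esub> t) (src XH c), \<one>\<^bsub>G\<^esub>)"
  "gmul Z (c, s) (d, t) = (gmul XH c (\<gamma>X s d), s \<otimes>\<^bsub>G\<^esub> t)"
  by (simp_all add: semidirect_groupoid_def gtop_XH)

lemma C_simps: "btop C = prod_topology total.orbs (gr_top G)" "proj C (c, t) = (proj AH c, t)"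
  "badd C (c, s) (d, t) = (badd AH c d, s)" "bscl C k (c, s) = (bscl AH k c, s)" "bnorm C (c, s) = bnorm AH c"
  "fmul C (c, s) (d, t) = (fmul AH c (\<gamma>A s d), s \<otimes>\<^bsub>G\<^esub> t)"
  by (simp_all add: semidirect_bundle_def btop_AH)

text \<open>
  Composability in the semidirect product is stated after moving by \<open>t\<close> inverse; moving back by
  \<open>t\<close> turns it into a condition on orbits.
\<close>

lemma src_orb_moved:
  assumes "t \<in> carrier G" "c \<in> topspace base.orbs" "y \<in> arrows X"
    and eq: "\<gamma>X (inv\<^bsub>G\<^esub> t) (src XH c) = orbX y"
  shows "src XH c = orbX (\<alpha>X t y)"
proof -
  obtain x where x: "x \<in> arrows X" "c = orbX x" using assms(2) by (rule base.orbs_E)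
  then have "src XH c \<in> topspace base.orbs"
    by (simp add: src_XH base.orb_in_orbs src_closed)
  then have "src XH c = \<gamma>X t (\<gamma>X (inv\<^bsub>G\<^esub> t) (src XH c))"
    using assms(1) by (simp only: GX.left_orb_assoc GX.G.inv_closed GX.G.r_inv GX.left_orb_one)
  then show ?thesis
    using assms by (simp only: eq GX.left_orb)
qed

lemma Z_repE:
  assumes "z \<in> arrows Z" "y \<in> arrows X" "src Z z = \<rho> y"
  obtains x t where "x \<in> arrows X" "t \<in> carrier G" "z = (orbX x, t)" "src X x = rng X (\<alpha>X t y)"
proof -
  obtain c t where z: "z = (c, t)" "c \<in> arrows XH" "t \<in> carrier G"
    using assms(1) by (auto simp: Z_simps gtop_XH GX.left_top)
  then have "src XH c = orbX (rng X (\<alpha>X t y))"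
    using src_orb_moved [of t c "rng X y"] assms by (simp add: Z_simps gtop_XH groupoid_simps rng_left)
  then show ?thesis
    using XH_composableE [OF z(2) GX.left_closed [OF z(3) assms(2)]] z that by metis
qed

lemma C_repE:
  assumes "c \<in> tot_space C" "b \<in> tot_space A" "src Z (proj C c) = \<rho> (proj A b)"
  obtains a t where "a \<in> tot_space A" "t \<in> carrier G" "c = (orbA a, t)"
    "src X (proj A a) = rng X (proj A (\<alpha>A t b))"
proof -
  obtain d t where c: "c = (d, t)" "d \<in> tot_space AH" "t \<in> carrier G"
    using assms(1) by (auto simp: C_simps btop_AH GX.left_top)
  obtain a where "a \<in> tot_space A" "d = orbA a" using c(2) by (rule tot_AH_E)
  then have "proj AH d \<in> topspace base.orbs"
    by (simp add: proj_AH base.orb_in_orbs proj_closed)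
  then have "src XH (proj AH d) = orbX (rng X (proj A (\<alpha>A t b)))"
    using src_orb_moved [of t "proj AH d" "rng X (proj A b)"] assms c
    by (simp add: Z_simps C_simps bundle_simps left_simps)
  then show ?thesis
    using AH_composableE [OF c(2) proj_closed [OF GA.left_closed [OF c(3) assms(2)]]] c that by metis
qed

lemma units_Z: "units Z = units XH \<times> {\<one>\<^bsub>G\<^esub>}"
  by (auto simp: units_def Z_simps gtop_XH GX.left_top)

text \<open>If \<open>x\<close> and its range lie in one orbit, freeness on the range forces them to agree.\<close>

lemma orb_in_units_XH_iff: "x \<in> arrows X \<Longrightarrow> orbX x \<in> units XH \<longleftrightarrow> x \<in> units X"
proof
  assume x: "x \<in> arrows X"
  show "x \<in> units X" if "orbX x \<in> units XH"
  proof -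
    have "orbX (rng X x) = orbX x"
      using that x by (simp add: units_def rng_XH)
    then show ?thesis
      using x base_rng.same_orb_eqI [of "rng X x" x] by (simp add: units_def groupoid_simps)
  qed
  show "orbX x \<in> units XH" if "x \<in> units X"
    using that x by (simp add: units_def rng_XH gtop_XH base.orb_in_orbs)
qed

lemma fibring_continuous: "continuous_map (gtop X) (subtopology (gtop Z) (units Z)) \<rho>"
  using continuous_map_compose [OF rng_continuous [OF lc_groupoid] base.orb_continuous]
  by (auto simp: continuous_map_in_subtopology continuous_map_paired Z_simps units_Z o_def GX.left_top
      orb_in_units_XH_iff rng_closed rng_in_units)

text \<open>
  A unit of the orbit groupoid is the orbit of units only, so if \<open>V\<close> is open in \<open>X\<close> then the orbits
  of \<open>V \<inter> units X\<close> are the units among the orbits of \<open>V\<close>.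
\<close>

lemma fibring_open:
  assumes "open_map (gtop X) (subtopology (gtop X) (units X)) (rng X)"
  shows "open_map (gtop X) (subtopology (gtop Z) (units Z)) \<rho>"
  unfolding open_map_def
proof (intro allI impI)
  fix U assume "openin (gtop X) U"
  then have "openin (subtopology (gtop X) (units X)) (rng X ` U)"
    using assms by (simp add: open_map_def)
  then obtain V where V: "openin (gtop X) V" "rng X ` U = V \<inter> units X"
    by (auto simp: openin_subtopology)
  have "openin (gtop Z) ((orbX ` V) \<times> carrier G)"
    using base.orb_open V(1) GX.left_top
    by (auto simp: Z_simps openin_prod_Times_iff open_map_def) (metis openin_topspace)
  moreover have "\<rho> ` U = (orbX ` V \<times> carrier G) \<inter> units Z"
  proof -
    have "\<rho> ` U = orbX ` (rng X ` U) \<times> {\<one>\<^bsub>G\<^esub>}" by auto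
    also have "orbX ` (rng X ` U) = orbX ` V \<inter> units XH"
      unfolding V(2) using openin_subset [OF V(1)] orb_in_units_XH_iff by auto
    finally show ?thesis
      by (auto simp: units_Z)
  qed
  ultimately show "openin (subtopology (gtop Z) (units Z)) (\<rho> ` U)"
    by (auto simp: openin_subtopology)
qed

lemma space_act_continuous:
  "continuous_map (subtopology (prod_topology (gtop Z) (gtop X)) {(z, u). src Z z = \<rho> u}) (gtop X)
     (\<lambda>(z, u). space_act z u)"
proof -
  let ?P = "subtopology (prod_topology (gtop Z) (gtop X)) {(z, u). src Z z = \<rho> u}"
  have z: "continuous_map ?P (gtop Z) fst" and y: "continuous_map ?P (gtop X) snd"
    by (auto intro: continuous_map_from_subtopology continuous_map_fst continuous_map_snd)
  have c: "continuous_map ?P base.orbs (\<lambda>p. fst (fst p))" and t: "continuous_map ?P (gr_top G) (\<lambda>p. snd (fst p))"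
    using continuous_map_compose [OF z [unfolded Z_simps(1)] continuous_map_fst]
      continuous_map_compose [OF z [unfolded Z_simps(1)] continuous_map_snd]
    by (simp_all add: o_def Z_simps(1))
  let ?y = "\<lambda>p. \<alpha>X (snd (fst p)) (snd p)"
  have ty: "continuous_map ?P (gtop X) ?y"
    by (rule continuous_map_compose_pair_total [OF t y GX.left_continuous])
  then have w: "continuous_map ?P (gtop X) (\<lambda>p. rng X (?y p))"
    using continuous_map_compose [OF _ rng_continuous [OF lc_groupoid]] by (auto simp: o_def)
  have rep: "\<exists>x. x \<in> arrows X \<and> fst (fst p) = orbX x \<and> src X x = rng X (?y p)" if "p \<in> topspace ?P" for p
  proof -
    have "fst p \<in> arrows Z" "snd p \<in> arrows X" "src Z (fst p) = \<rho> (snd p)"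
      using that by auto
    then show ?thesis
      by (rule Z_repE) auto
  qed
  have "continuous_map ?P (gtop X) (\<lambda>p. base_src.lift (fst (fst p)) (rng X (?y p)))"
  proof (rule continuous_map_compose_pair [OF c w base_src.lift_continuous])
    fix p assume "p \<in> topspace ?P"
    with rep [of p] show "(fst (fst p), rng X (?y p)) \<in> {(c, w). src XH c = orbX w}"
      by (auto simp: src_XH)
  qed (simp add: src_XH)
  then have "continuous_map ?P (gtop X) (\<lambda>p. gmul X (base_src.lift (fst (fst p)) (rng X (?y p))) (?y p))"
  proof (rule continuous_map_compose_pair [OF _ ty])
    show "continuous_map (subtopology (prod_topology (gtop X) (gtop X)) {(x, y). src X x = rng X y}) (gtop X)
      (\<lambda>(x, y). gmul X x y)"
      using lc_groupoid by (simp add: lc_groupoid_def)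
    fix p assume "p \<in> topspace ?P"
    then obtain x where x: "x \<in> arrows X" "fst (fst p) = orbX x" "src X x = rng X (?y p)"
      using rep by blast
    then have "base_src.lift (fst (fst p)) (rng X (?y p)) = x"
      using base_src.lift_orb [of x] by simp
    then show "(base_src.lift (fst (fst p)) (rng X (?y p)), ?y p) \<in> {(x, y). src X x = rng X y}"
      using x(3) by simp
  qed
  then show ?thesis
    by (simp add: space_act_def case_prod_unfold)
qed

lemma bundle_act_continuous:
  "continuous_map (subtopology (prod_topology (btop C) (btop A)) {(c, b). src Z (proj C c) = \<rho> (proj A b)}) (btop A)
     (\<lambda>(c, b). bundle_act c b)"
proof -
  let ?P = "subtopology (prod_topology (btop C) (btop A)) {(c, b). src Z (proj C c) = \<rho> (proj A b)}"
  have z: "continuous_map ?P (btop C) fst" and b: "continuous_map ?P (btop A) snd"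
    by (auto intro: continuous_map_from_subtopology continuous_map_fst continuous_map_snd)
  have c: "continuous_map ?P total.orbs (\<lambda>p. fst (fst p))" and t: "continuous_map ?P (gr_top G) (\<lambda>p. snd (fst p))"
    using continuous_map_compose [OF z [unfolded C_simps(1)] continuous_map_fst]
      continuous_map_compose [OF z [unfolded C_simps(1)] continuous_map_snd]
    by (simp_all add: o_def C_simps(1))
  let ?b = "\<lambda>p. \<alpha>A (snd (fst p)) (snd p)"
  have tb: "continuous_map ?P (btop A) ?b"
    by (rule continuous_map_compose_pair_total [OF t b GA.left_continuous])
  have w: "continuous_map ?P (gtop X) (\<lambda>p. rng X (proj A (?b p)))"
    using continuous_map_compose [OF continuous_map_compose [OF tb proj_continuous] rng_continuous [OF lc_groupoid]]
    by (simp add: o_def)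
  have rep: "\<exists>a. a \<in> tot_space A \<and> fst (fst p) = orbA a \<and> src X (proj A a) = rng X (proj A (?b p))"
    if "p \<in> topspace ?P" for p
  proof -
    have "fst p \<in> tot_space C" "snd p \<in> tot_space A" "src Z (proj C (fst p)) = \<rho> (proj A (snd p))"
      using that by auto
    then show ?thesis
      by (rule C_repE) auto
  qed
  have "continuous_map ?P (btop A) (\<lambda>p. total_src.lift (fst (fst p)) (rng X (proj A (?b p))))"
  proof (rule continuous_map_compose_pair [OF c w total_src.lift_continuous])
    fix p assume "p \<in> topspace ?P"
    with rep [of p] show "(fst (fst p), rng X (proj A (?b p))) \<in> {(c, w). src XH (proj AH c) = orbX w}"
      by (auto simp: src_XH proj_AH proj_closed)
  qed (simp add: src_XH proj_AH proj_closed)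
  then have "continuous_map ?P (btop A) (\<lambda>p. fmul A (total_src.lift (fst (fst p)) (rng X (proj A (?b p)))) (?b p))"
  proof (rule continuous_map_compose_pair [OF _ tb fmul_continuous])
    fix p assume "p \<in> topspace ?P"
    then obtain a where a: "a \<in> tot_space A" "fst (fst p) = orbA a" "src X (proj A a) = rng X (proj A (?b p))"
      using rep by blast
    then have "total_src.lift (fst (fst p)) (rng X (proj A (?b p))) = a"
      using total_src.lift_orb [of a] by simp
    then show "(total_src.lift (fst (fst p)) (rng X (proj A (?b p))), ?b p)
        \<in> {(a, b). src X (proj A a) = rng X (proj A b)}"
      using a(3) by simp
  qed
  then show ?thesis
    by (simp add: bundle_act_def case_prod_unfold)
qed

theorem groupoid_space_action_semidirect:
  assumes "open_map (gtop X) (subtopology (gtop X) (units X)) (rng X)"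
  shows "groupoid_space_action Z (gtop X) \<rho> space_act"
  unfolding groupoid_space_action_def
proof (intro conjI ballI impI)
  show "continuous_map (gtop X) (subtopology (gtop Z) (units Z)) \<rho>" by (rule fibring_continuous)
  show "open_map (gtop X) (subtopology (gtop Z) (units Z)) \<rho>" by (rule fibring_open [OF assms])
  show "continuous_map (subtopology (prod_topology (gtop Z) (gtop X)) {(z, u). src Z z = \<rho> u}) (gtop X)
     (\<lambda>(z, u). space_act z u)" by (rule space_act_continuous)
next
  fix z u assume zu: "z \<in> arrows Z" "u \<in> arrows X" "src Z z = \<rho> u"
  then obtain x t where "x \<in> arrows X" "t \<in> carrier G" "z = (orbX x, t)" "src X x = rng X (\<alpha>X t u)"
    by (rule Z_repE)
  then show "\<rho> (space_act z u) = rng Z z"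
    using zu(2) by (simp add: space_act_orb Z_simps rng_XH rng_mult GX.left_closed)
next
  fix u assume "u \<in> arrows X"
  then show "space_act (\<rho> u) u = u"
    by (simp add: space_act_orb GX.left_one groupoid_simps)
next
  fix z w u assume *: "z \<in> arrows Z" "w \<in> arrows Z" "u \<in> arrows X" "src Z z = rng Z w \<and> src Z w = \<rho> u"
  then obtain y t where y: "y \<in> arrows X" "t \<in> carrier G" "w = (orbX y, t)" "src X y = rng X (\<alpha>X t u)"
    using Z_repE [OF *(2,3)] by blast
  then have "src Z z = \<rho> y"
    using * by (simp add: Z_simps rng_XH)
  then obtain x s where x: "x \<in> arrows X" "s \<in> carrier G" "z = (orbX x, s)" "src X x = rng X (\<alpha>X s y)"
    using Z_repE [OF *(1) y(1)] by blast
  have "space_act (gmul Z z w) u = gmul X (gmul X x (\<alpha>X s y)) (\<alpha>X s (\<alpha>X t u))"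
    using x y *(3) by (simp add: Z_simps GX.left_orb gmul_XH space_act_orb GX.left_closed mult_closed
        src_mult src_left rng_left GX.left_assoc rng_closed)
  also have "\<dots> = gmul X x (\<alpha>X s (gmul X y (\<alpha>X t u)))"
    using x y *(3) by (simp add: gmul_left mult_assoc GX.left_closed src_left rng_left)
  also have "\<dots> = space_act z (space_act w u)"
    using x y *(3) by (simp add: space_act_orb mult_closed rng_mult GX.left_closed rng_left)
  finally show "space_act (gmul Z z w) u = space_act z (space_act w u)" .
qed

text \<open>
  All elements of the fibre over \<open>(x H, t)\<close> have representatives over the same arrow \<open>x\<close> with
  \<open>s(x) = r(t w)\<close>, and on these the action is the multiplication of the Fell bundle.
\<close>

lemma bundle_act_bilinear:
  assumes z: "z \<in> arrows Z" and w: "w \<in> arrows X" and zw: "src Z z = \<rho> w"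
  shows "bilinear_between (fibre C z) (fibre A w) (fibre A (space_act z w)) bundle_act"
proof -
  obtain x t where x: "x \<in> arrows X" "t \<in> carrier G" "z = (orbX x, t)" "src X x = rng X (\<alpha>X t w)"
    using z w zw by (rule Z_repE)
  have act: "bundle_act (orbA a, t) b = fmul A a (\<alpha>A t b)"
    if "a \<in> tot_space A" "proj A a = x" "b \<in> tot_space A" "proj A b = w" for a b
    using that x by (simp add: bundle_act_orb proj_left)
  have fib: "\<exists>a. a \<in> tot_space A \<and> proj A a = x \<and> c = (orbA a, t)" if "c \<in> npts (fibre C z)" for c
  proof -
    have c: "c = (fst c, t)" "fst c \<in> tot_space AH" "proj AH (fst c) = orbX x"
      using that x(3) by (cases c; simp add: fibre_def C_simps btop_AH)+
    then obtain a where "a \<in> tot_space A" "fst c = orbA a" "proj A a = x"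
      using x(1) by (metis AH_fibreE)
    then show ?thesis
      using c(1) by metis
  qed
  have bil: "bilinear_between (fibre A x) (fibre A (\<alpha>X t w)) (fibre A (space_act z w)) (fmul A)"
    using fmul_bilinear [of x "\<alpha>X t w"] x w by (simp add: space_act_orb GX.left_closed)
  have fib_left: "\<alpha>A t b \<in> npts (fibre A (\<alpha>X t w))" if "b \<in> npts (fibre A w)" for b
    using that x(2) by (simp add: fibre_def proj_left GA.left_closed)
  show ?thesis
    unfolding bilinear_between_def
  proof (intro conjI ballI)
    fix c assume "c \<in> npts (fibre C z)"
    then obtain a where a: "a \<in> tot_space A" "proj A a = x" "c = (orbA a, t)"
      using fib by blast
    then have lin: "linear_between (fibre A (\<alpha>X t w)) (fibre A (space_act z w)) (fmul A a)"
      using bil by (simp add: bilinear_between_def fibre_def)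
    show "linear_between (fibre A w) (fibre A (space_act z w)) (bundle_act c)"
      using lin fib_left a x(2) unfolding linear_between_def
      by (auto simp: fibre_def act badd_closed proj_badd bscl_closed proj_bscl badd_left bscl_left)
  next
    fix b assume b: "b \<in> npts (fibre A w)"
    then have lin: "linear_between (fibre A x) (fibre A (space_act z w)) (\<lambda>a. fmul A a (\<alpha>A t b))"
      using bil fib_left by (simp add: bilinear_between_def)
    have b': "b \<in> tot_space A" "proj A b = w"
      using b by (simp_all add: fibre_def)
    show "linear_between (fibre C z) (fibre A (space_act z w)) (\<lambda>c. bundle_act c b)"
      unfolding linear_between_def
    proof (intro conjI ballI allI)
      fix c assume "c \<in> npts (fibre C z)"
      then obtain a where a: "a \<in> tot_space A" "proj A a = x" "c = (orbA a, t)"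
        using fib by blast
      then show "bundle_act c b \<in> npts (fibre A (space_act z w))"
        using lin b' by (simp add: act linear_between_def fibre_def)
      show "bundle_act (nscl (fibre C z) k c) b = nscl (fibre A (space_act z w)) k (bundle_act c b)" for k
        using lin a b' by (simp add: act linear_between_def fibre_def C_simps bscl_AH bscl_closed proj_bscl)
      fix d assume "d \<in> npts (fibre C z)"
      then obtain a' where a': "a' \<in> tot_space A" "proj A a' = x" "d = (orbA a', t)"
        using fib by blast
      then show "bundle_act (nadd (fibre C z) c d) b
          = nadd (fibre A (space_act z w)) (bundle_act c b) (bundle_act d b)"
        using lin a b' by (simp add: act linear_between_def fibre_def C_simps badd_AH badd_closed proj_badd)
    qed
  qed
qed

theorem fell_bundle_action_semidirect:
  assumes "open_map (gtop X) (subtopology (gtop X) (units X)) (rng X)"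
  shows "fell_bundle_action Z C (gtop X) A \<rho> space_act bundle_act"
  unfolding fell_bundle_action_def
proof (intro conjI ballI impI)
  show "groupoid_space_action Z (gtop X) \<rho> space_act"
    by (rule groupoid_space_action_semidirect [OF assms])
  show "continuous_map (subtopology (prod_topology (btop C) (btop A)) {(c, e). src Z (proj C c) = \<rho> (proj A e)})
      (btop A) (\<lambda>(c, e). bundle_act c e)"
    by (rule bundle_act_continuous)
next
  fix z w assume "z \<in> arrows Z" "w \<in> arrows X" "src Z z = \<rho> w"
  then show "bilinear_between (fibre C z) (fibre A w) (fibre A (space_act z w)) bundle_act"
    by (rule bundle_act_bilinear)
next
  fix c e assume ce: "c \<in> tot_space C" "e \<in> tot_space A" "src Z (proj C c) = \<rho> (proj A e)"
  then obtain a t where a: "a \<in> tot_space A" "t \<in> carrier G" "c = (orbA a, t)"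
    "src X (proj A a) = rng X (proj A (\<alpha>A t e))"
    by (rule C_repE)
  then show "bnorm A (bundle_act c e) \<le> bnorm C c * bnorm A e"
    using norm_fmul [OF a(1) GA.left_closed [OF a(2) ce(2)] a(4)] ce(2)
    by (simp add: bundle_act_orb C_simps bnorm_AH bnorm_left)
next
  fix c d e assume *: "c \<in> tot_space C" "d \<in> tot_space C" "e \<in> tot_space A"
    "src Z (proj C c) = rng Z (proj C d) \<and> src Z (proj C d) = \<rho> (proj A e)"
  then obtain b t where b: "b \<in> tot_space A" "t \<in> carrier G" "d = (orbA b, t)"
    "src X (proj A b) = rng X (proj A (\<alpha>A t e))"
    using C_repE [OF *(2,3)] by blast
  then have "src Z (proj C c) = \<rho> (proj A b)"
    using * by (simp add: Z_simps C_simps rng_XH proj_AH proj_closed)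
  then obtain a s where a: "a \<in> tot_space A" "s \<in> carrier G" "c = (orbA a, s)"
    "src X (proj A a) = rng X (proj A (\<alpha>A s b))"
    using C_repE [OF *(1) b(1)] by blast
  have "bundle_act (fmul C c d) e = fmul A (fmul A a (\<alpha>A s b)) (\<alpha>A s (\<alpha>A t e))"
    using a b *(3) by (simp add: C_simps GA.left_orb fmul_AH bundle_act_orb GA.left_closed GA.left_assoc
        bundle_simps proj_left src_left rng_left GX.left_closed GX.left_assoc)
  also have "\<dots> = fmul A a (\<alpha>A s (fmul A b (\<alpha>A t e)))"
    using a b *(3) by (simp add: fmul_left fmul_assoc GA.left_closed proj_left src_left rng_left
        bundle_simps GX.left_closed)
  also have "\<dots> = bundle_act c (bundle_act d e)"
    using a b *(3) by (simp add: bundle_act_orb bundle_simps GA.left_closed GX.left_closed proj_left rng_left)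
  finally show "bundle_act c (bundle_act d e) = bundle_act (fmul C c d) e"
    by (rule sym)
qed

end

theorem propositionA15:
  fixes X :: "'x groupoid" and A :: "('a, 'x) fell"
    and G :: "'g top_group" and H :: "'h top_group"
    and \<alpha>X :: "'g \<Rightarrow> 'x \<Rightarrow> 'x" and \<alpha>A :: "'g \<Rightarrow> 'a \<Rightarrow> 'a"
    and \<beta>X :: "'x \<Rightarrow> 'h \<Rightarrow> 'x" and \<beta>A :: "'a \<Rightarrow> 'h \<Rightarrow> 'a"
  assumes X: "lc_groupoid X" "\<exists>\<nu>. left_haar_system X \<nu>"
    and A: "fell_bundle X A"
    and G: "lc_group G" and H: "lc_group H"
    and left: "left_fell_action G X A \<alpha>X \<alpha>A"
      "free_left_action G (gtop X) \<alpha>X" "proper_left_action G (gtop X) \<alpha>X"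
    and right: "right_fell_action H X A \<beta>X \<beta>A"
      "free_right_action H (gtop X) \<beta>X" "proper_right_action H (gtop X) \<beta>X"
    and commute:
      "\<And>s x h. s \<in> carrier G \<Longrightarrow> x \<in> arrows X \<Longrightarrow> h \<in> carrier H \<Longrightarrow>
         \<alpha>X s (\<beta>X x h) = \<beta>X (\<alpha>X s x) h"
      "\<And>s a h. s \<in> carrier G \<Longrightarrow> a \<in> tot_space A \<Longrightarrow> h \<in> carrier H \<Longrightarrow>
         \<alpha>A s (\<beta>A a h) = \<beta>A (\<alpha>A s a) h"
  shows "\<exists>\<gamma>X \<gamma>A.
     left_fell_action G (orbit_groupoid H X \<beta>X) (orbit_bundle H X A \<beta>X \<beta>A) \<gamma>X \<gamma>A \<and>
     (\<forall>s\<in>carrier G. \<forall>x\<in>arrows X. \<gamma>X s (orb H \<beta>X x) = orb H \<beta>X (\<alpha>X s x)) \<and>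
     (\<forall>s\<in>carrier G. \<forall>a\<in>tot_space A. \<gamma>A s (orb H \<beta>A a) = orb H \<beta>A (\<alpha>A s a)) \<and>
     (\<exists>m \<mu>.
       fell_bundle_action
         (semidirect_groupoid G (orbit_groupoid H X \<beta>X) \<gamma>X)
         (semidirect_bundle G (orbit_bundle H X A \<beta>X \<beta>A) \<gamma>A)
         (gtop X) A (\<lambda>x. (orb H \<beta>X (rng X x), \<one>\<^bsub>G\<^esub>)) m \<mu> \<and>
       (\<forall>x\<in>arrows X. \<forall>t\<in>carrier G. \<forall>y\<in>arrows X. src X x = rng X (\<alpha>X t y) \<longrightarrow>
         m (orb H \<beta>X x, t) y = gmul X x (\<alpha>X t y)) \<and>
       (\<forall>a\<in>tot_space A. \<forall>t\<in>carrier G. \<forall>b\<in>tot_space A.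
         src X (proj A a) = rng X (proj A (\<alpha>A t b)) \<longrightarrow>
         \<mu> (orb H \<beta>A a, t) b = fmul A a (\<alpha>A t b)))"
proof -
  interpret commuting_fell_actions X A H \<beta>X \<beta>A G \<alpha>X \<alpha>A
    using X(1) A G H left(1) right commute
    by unfold_locales (simp_all add: lc_groupoid_def)
  obtain \<nu> where "left_haar_system X \<nu>" using X(2) by blast
  then have "open_map (gtop X) (subtopology (gtop X) (units X)) (rng X)"
    using X(1) rng_in_units rng_continuous [OF X(1)]
    by (intro haar_system_imp_open_rng) (auto simp: lc_groupoid_def)
  then have "fell_bundle_action Z C (gtop X) A \<rho> space_act bundle_act"
    by (rule fell_bundle_action_semidirect)
  then show ?thesis
    using left_fell_action_orbit_bundle
    by (intro exI [of _ \<gamma>X] exI [of _ \<gamma>A] conjI exI [of _ space_act] exI [of _ bundle_act])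
      (simp_all add: GX.left_orb GA.left_orb space_act_orb bundle_act_orb)
qed

end
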